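(* Let $l\in\{3,4\}$, let $d\ge1$ be a fixed integer, and for each positive integer $m$ put $s=\frac{m+d}{l+d}$. Then, as $m\to\infty$ with $d$ fixed, $$f_0^{s}(l,m)\sim\left\{1-\left(1-\frac{1}{l+d}\right)^{l}\right\}\binom{m}{l}.$$
   Context: An $l$-graph ($l$-uniform hypergraph) is a pair $H=(V,E)$ with $V$ finite and $E\subseteq\binom{V}{l}$. A fractional matching in $H$ is a function $w:E\to[0,1]$ with $\sum_{e\ni v}w(e)\le 1$ for every $v\in V$; its size is $\sum_{e\in E}w(e)$, and $\nu^*(H)$ is the maximum size of a fractional matching. For a real number $0\le s\le m/l$, $f_0^s(l,m)$ is the minimum integer $M$ such that every $l$-graph $H$ on $m$ vertices with at least $M$ edges satisfies $\nu^*(H)\ge s$. $a_m\sim b_m$ means $a_m/b_m\to1$ as $m\to\infty$. *)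

theory Defs
  imports "HOL-Analysis.Analysis" "HOL-Library.Landau_Symbols" "HOL-Library.Ramsey"
begin

definition uniform_hypergraph :: "nat \<Rightarrow> 'a set \<Rightarrow> 'a set set \<Rightarrow> bool" where
  "uniform_hypergraph l V E \<longleftrightarrow> finite V \<and> E \<subseteq> nsets V l"

text \<open>A weighting is a function on all sets of vertices; its values outside \<open>E\<close> are irrelevant.\<close>

definition fractional_matching :: "'a set \<Rightarrow> 'a set set \<Rightarrow> ('a set \<Rightarrow> real) \<Rightarrow> bool" where
  "fractional_matching V E w \<longleftrightarrow>
     (\<forall>e\<in>E. 0 \<le> w e \<and> w e \<le> 1) \<and> (\<forall>v\<in>V. (\<Sum>e | e \<in> E \<and> v \<in> e. w e) \<le> 1)"

text \<open>The supremum is a maximum, see \<open>fractional_matching_number_attained\<close>.\<close>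

definition fractional_matching_number :: "'a set \<Rightarrow> 'a set set \<Rightarrow> real" where
  "fractional_matching_number V E = Sup {\<Sum>e\<in>E. w e | w. fractional_matching V E w}"

lemma fractional_matching_number_attained:
  assumes "uniform_hypergraph l V E"
  shows "\<exists>w. fractional_matching V E w \<and> (\<Sum>e\<in>E. w e) = fractional_matching_number V E"
    and "\<And>w. fractional_matching V E w \<Longrightarrow> (\<Sum>e\<in>E. w e) \<le> fractional_matching_number V E"
proof -
  let ?S = "{\<Sum>e\<in>E. w e | w. fractional_matching V E w}"
  define K where "K = {w :: 'a set \<Rightarrow> real. (\<forall>e. w e \<in> {0..1})}
    \<inter> (\<Inter>v\<in>V. {w. (\<Sum>e | e \<in> E \<and> v \<in> e. w e) \<le> 1})"
  have "compactin (product_topology (\<lambda>_. euclidean) UNIV) (\<Pi>\<^sub>E e\<in>(UNIV::'a set set). {0..1::real})"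
    by (subst compactin_PiE) auto
  then have c: "compact {w :: 'a set \<Rightarrow> real. (\<forall>e. w e \<in> {0..1})}"
    by (simp add: PiE_UNIV_domain Pi_def euclidean_product_topology)
  have cl: "closed (\<Inter>v\<in>V. {w :: 'a set \<Rightarrow> real. (\<Sum>e | e \<in> E \<and> v \<in> e. w e) \<le> 1})"
    by (intro closed_INT ballI closed_Collect_le continuous_intros)
       (auto intro: continuous_on_product_coordinates)
  have "compact K"
    unfolding K_def by (rule compact_Int_closed[OF c cl])
  then have comp: "compact ((\<lambda>w. \<Sum>e\<in>E. w e) ` K)"
    by (intro compact_continuous_image continuous_intros)
       (auto intro: continuous_on_subset[OF continuous_on_product_coordinates])
  have "(\<lambda>_. 0) \<in> K" by (auto simp: K_def)
  then have ne: "(\<lambda>w. \<Sum>e\<in>E. w e) ` K \<noteq> {}" by blast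
  have S: "?S = (\<lambda>w. \<Sum>e\<in>E. w e) ` K"
  proof (intro equalityI subsetI)
    fix x assume "x \<in> ?S"
    then obtain w where w: "fractional_matching V E w" "x = (\<Sum>e\<in>E. w e)" by auto
    define u where "u e = (if e \<in> E then w e else 0)" for e
    have "u \<in> K" using w(1) by (auto simp: K_def fractional_matching_def u_def)
    moreover have "x = (\<Sum>e\<in>E. u e)" by (simp add: w(2) u_def)
    ultimately show "x \<in> (\<lambda>w. \<Sum>e\<in>E. w e) ` K" by blast
  qed (auto simp: K_def fractional_matching_def)
  obtain m where m: "m \<in> ?S" "\<And>x. x \<in> ?S \<Longrightarrow> x \<le> m"
    unfolding S using compact_attains_sup[OF comp ne] by blast
  then have "fractional_matching_number V E = m"
    unfolding fractional_matching_number_def by (intro cSup_eq_maximum) auto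
  with m show "\<exists>w. fractional_matching V E w \<and> (\<Sum>e\<in>E. w e) = fractional_matching_number V E"
    and "\<And>w. fractional_matching V E w \<Longrightarrow> (\<Sum>e\<in>E. w e) \<le> fractional_matching_number V E"
    by auto
qed

text \<open>
  Meaningful for \<open>0 \<le> s \<le> m / l\<close>. Every \<open>l\<close>-graph on \<open>m\<close> vertices is isomorphic to one whose
  vertices are natural numbers. For \<open>s > 0\<close> no integer below 1 qualifies, because the edgeless
  graph has no fractional matching of positive size; so nothing is lost by taking the minimum
  over the natural numbers. It exists because every \<open>M > m choose l\<close> qualifies vacuously.
\<close>

definition f0 :: "real \<Rightarrow> nat \<Rightarrow> nat \<Rightarrow> nat" where
  "f0 s l m = (LEAST M. \<forall>(V :: nat set) E.
     uniform_hypergraph l V E \<and> card V = m \<and> card E \<ge> M \<longrightarrow> fractional_matching_number V E \<ge> s)"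

end

theory Submission
  imports Defs "HOL-Combinatorics.Multiset_Permutations" "HOL-Real_Asymp.Real_Asymp"
begin

text \<open>
  For the lower bound take all \<open>l\<close>-sets that meet a fixed set of just under \<open>s\<close> vertices.

  For the upper bound, a hypergraph without a fractional matching of size \<open>s\<close> has a fractional
  vertex cover of total weight at most \<open>s\<close>. After adding \<open>d\<close> vertices of weight 0 the weight of a
  random vertex has mean at most \<open>1 / (l + d)\<close>, and every edge yields \<open>l!\<close> heavy tuples, that is, tuples
  of total weight at least 1. So one needs \<open>P(X\<^sub>1 + \<dots> + X\<^sub>l < 1) \<ge> (1 - x)^l\<close> for independent
  nonnegative \<open>X\<^sub>i\<close> of mean \<open>x \<le> 1 / (l + 1)\<close>, a case of Samuels' inequality. Mixing with an atom at
  1 reduces it to \<open>x = 1 / (l + 1)\<close>; as the probability is linear in each law and every law of mean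
  \<open>x\<close> is a mixture of laws on two points with the same mean, two-point laws suffice. Subtracting the
  smaller value of each and rescaling leaves \<open>l\<close> independent variables with values in \<open>{0, u\<^sub>i}\<close> and
  means \<open>\<mu>\<^sub>i\<close> such that \<open>\<mu>\<^sub>k + \<Sum>\<mu>\<^sub>i \<le> 1\<close> for all \<open>k\<close>. The minimum \<open>(l / (l + 1))^l\<close> is attained when
  all \<open>u\<^sub>i \<ge> 1\<close>; all other configurations of heavy sets are estimated separately. The case \<open>l = 3\<close> is
  \<open>l = 4\<close> with \<open>u\<^sub>4 = 0\<close>.
\<close>

subsection \<open>Polynomial inequalities\<close>

text \<open>The atom at 1 costs nothing: if the old law keeps a weight \<open>c\<close> with
  \<open>c * (1 - x) = l / (l + 1)\<close>, the mean becomes \<open>1 / (l + 1)\<close>, every tuple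
  that uses the atom is heavy, and the probability of a light tuple is multiplied by
  \<open>c^l\<close>. The bound \<open>(l / (l + 1))^l = c^l * (1 - x)^l\<close> then returns
  \<open>(1 - x)^l\<close>.

  In the four-variable problem the constraints are increasing in the values, while a case only
  prescribes which sums of values reach 1. Values are therefore mostly eliminated by passing to an
  extreme point of the region that the case allows, which leaves polynomial inequalities in the
  probabilities.

  The difficulty is the small slack. The targets are \<open>256/625\<close> for \<open>l = 4\<close>
  and \<open>27/64\<close> for \<open>l = 3\<close>, and the second is larger, so each case must
  reach \<open>27/64\<close> when \<open>u4 = 0\<close>. For \<open>u1 + u2 >= 1 > u3 + u4\<close>
  the general bound is \<open>5/12\<close>, which lies between the two targets; there
  \<open>u4 = 0\<close> enters once more, through \<open>u2 >= 1/2\<close>.\<close>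

lemma bilinear_bound:
  fixes A B N X Y b :: real
  assumes "0 \<le> Y" "Y \<le> X" "2 * X + Y \<le> N" "0 \<le> A" "A * N / 2 \<le> b" "2 * A * N / 3 + B * N^2 / 9 \<le> b"
  shows "A * (X + Y) + B * (X * Y) \<le> b"
\<comment> \<open>The region is a triangle with corners \<open>(0, 0)\<close>,
  \<open>(N/2, 0)\<close> and \<open>(N/3, N/3)\<close>; the last two assumptions are the bound at
  the nonzero corners. For \<open>B >= 0\<close> both \<open>X + Y\<close> and \<open>X * Y\<close>
  are largest at \<open>(N/3, N/3)\<close>.\<close>
proof (cases "0 \<le> B")
  case True
  have "0 \<le> A * (2 * N - 3 * (X + Y))" using assms by (intro mult_nonneg_nonneg) auto
  moreover have "9 * (X * Y) \<le> N^2"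
  proof -
    have "(2 * X + Y)^2 \<le> N^2" using assms by (intro power_mono) auto
    moreover have "0 \<le> (X - Y) * (4 * X - Y)" using assms by (intro mult_nonneg_nonneg) auto
    ultimately show ?thesis by (simp only: algebra_simps power2_eq_square, linarith?)
  qed
  then have "0 \<le> B * (N^2 - 9 * (X * Y))" using True by (intro mult_nonneg_nonneg) auto
  ultimately show ?thesis using assms(6) by (simp only: algebra_simps power2_eq_square, linarith?)
next
  case False
  define S where "S = X + Y"
  show ?thesis
  proof (cases "S \<le> N / 2")
    case True
    have "A * S \<le> A * (N / 2)" using assms True by (intro mult_left_mono) auto
    moreover have "B * (X * Y) \<le> 0" using False assms by (intro mult_nonpos_nonneg) auto
    ultimately show ?thesis using assms(5) by (simp add: S_def)
  next
    case S: False
    \<comment> \<open>For \<open>B < 0\<close> and fixed \<open>S\<close> the product is smallest on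
      the edge \<open>2 * X + Y = N\<close>, where \<open>Y = t\<close>. Along that edge it is
      concave in \<open>t\<close>, hence above its chord \<open>N * t / 3\<close>, and the estimate
      becomes affine in \<open>t\<close> between two corners.\<close>
    define t where "t = 2 * S - N"
    have N: "0 < N" and t: "0 \<le> t" "3 * t \<le> N"
      using S assms by (auto simp: t_def S_def)
    have "0 \<le> (N - S - X) * (N - S + X - S)"
      using assms by (intro mult_nonneg_nonneg) (auto simp: S_def)
    then have "(N - S) * t \<le> X * Y"
      by (simp only: S_def t_def algebra_simps, linarith?)
    moreover have "0 \<le> t * (N - 3 * t)" using t by (intro mult_nonneg_nonneg) auto
    ultimately have "N * t \<le> 3 * (X * Y)"
      by (simp only: S_def t_def algebra_simps, linarith?)
    then have XY: "N * t / 3 \<le> X * Y" by simp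
    have "0 \<le> - B * (X * Y - N * t / 3)" using False XY by (intro mult_nonneg_nonneg) auto
    then have "N * (A * (X + Y) + B * (X * Y)) \<le> N * (A * (N + t) / 2 + B * (N * t / 3))"
      using N by (intro mult_left_mono) (auto simp: S_def t_def field_simps)
    also have "\<dots> = (N - 3 * t) * (A * N / 2) + 3 * t * (2 * A * N / 3 + B * N^2 / 9)"
      by (simp add: field_simps power2_eq_square)
    also have "\<dots> \<le> (N - 3 * t) * b + 3 * t * b"
      using assms t by (intro add_mono mult_left_mono) auto
    finally have "N * (A * (X + Y) + B * (X * Y)) \<le> N * b" by (simp add: left_diff_distrib)
    then show ?thesis using N by simp
  qed
qed

section \<open>Avoiding values that are heavy on their own\<close>

lemma product2_ge:
  fixes x y :: real
  assumes "0 \<le> x" "0 \<le> y" "2 * x + y \<le> 1" "x + 2 * y \<le> 1"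
  shows "(1 - x) * (1 - y) \<ge> 4/9"
proof -
  have *: "(1 - x) * (1 - y) \<ge> 4/9" if "0 \<le> y" "y \<le> x" "2 * x + y \<le> 1" for x y :: real
    using bilinear_bound[of y x 1 1 "5/9" "-1"] that by (simp add: algebra_simps)
  show ?thesis using *[of y x] *[of x y] assms by (cases "y \<le> x") (auto simp: mult.commute)
qed

text \<open>Moving two numbers apart at constant sum lowers the product; one of them is pushed up to
  the cap \<open>k\<close>.\<close>

lemma merge_factors:
  fixes a b k :: real
  assumes "a \<le> k" "b \<le> k"
  shows "(1 - k) * (1 - (a + b - k)) \<le> (1 - a) * (1 - b)"
proof -
  have "0 \<le> (k - a) * (k - b)" using assms by (intro mult_nonneg_nonneg) auto
  then show ?thesis by (simp only: algebra_simps)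
qed

text \<open>For a fixed maximum \<open>k\<close>, spreading the other two at constant sum leads to
  \<open>(k, a + b - k)\<close> or, from \<open>k = 1/3\<close> on, to \<open>(0, a + b)\<close>,
  hence to \<open>3 * k * (1 - k)^2\<close> and \<open>2 * k * (1 - k)\<close>. Equality holds at
  \<open>x = y = z = 1/4\<close>.\<close>

lemma product3_ge:
  fixes x y z :: real
  assumes nn: "0 \<le> x" "0 \<le> y" "0 \<le> z"
    and le: "2 * x + y + z \<le> 1" "x + 2 * y + z \<le> 1" "x + y + 2 * z \<le> 1"
  shows "(1 - x) * (1 - y) * (1 - z) \<ge> 27/64"
proof -
  have *: "(1 - k) * ((1 - a) * (1 - b)) \<ge> 27/64"
    if "0 \<le> a" "0 \<le> b" "a \<le> k" "b \<le> k" "2 * k + a + b \<le> 1" for a b k :: real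
  proof -
    have "k \<le> 1/2" using that by linarith
    then consider "k \<le> 1/4" | "1/4 \<le> k" "k \<le> 1/3" | "1/3 \<le> k" "k \<le> 1/2" by linarith
    then show ?thesis
    proof cases
      case 1
      have "(3/4) * ((3/4) * (3/4)) \<le> (1 - k) * ((1 - a) * (1 - b))"
        using 1 that by (intro mult_mono) auto
      then show ?thesis by simp
    next
      case 2
      have "3 * k * (1 - k) \<le> (1 - k) * (1 - (a + b - k))"
        using 2 that by (subst mult.commute, intro mult_left_mono) auto
      also note merge_factors[OF that(3,4)]
      finally have "(1 - k) * (3 * k * (1 - k)) \<le> (1 - k) * ((1 - a) * (1 - b))"
        using 2 by (intro mult_left_mono) auto
      moreover have "27/64 \<le> (1 - k) * (3 * k * (1 - k))"
      proof -
        have "0 \<le> (k - 1/4) * ((1/3 - k) * (17/12 - k)) + (k - 1/4) * (13/144)"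
          using 2 by (intro add_nonneg_nonneg mult_nonneg_nonneg) auto
        then show ?thesis by (simp only: algebra_simps, linarith?)
      qed
      ultimately show ?thesis by linarith
    next
      case 3
      have "2 * k \<le> (1 - a) * (1 - b)"
        using that mult_nonneg_nonneg[OF that(1,2)] by (simp only: algebra_simps, linarith?)
      then have "(1 - k) * (2 * k) \<le> (1 - k) * ((1 - a) * (1 - b))"
        using 3 by (intro mult_left_mono) auto
      moreover have "0 \<le> (k - 1/3) * (1/2 - k)" using 3 by (intro mult_nonneg_nonneg) auto
      ultimately show ?thesis using 3 by (simp only: algebra_simps, linarith?)
    qed
  qed
  consider "y \<le> x \<and> z \<le> x" | "x \<le> y \<and> z \<le> y" | "x \<le> z \<and> y \<le> z" by linarith
  then show ?thesis
  proof cases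
    case 1 then show ?thesis using *[of y z x] assms by (auto simp: mult_ac)
  next
    case 2 then show ?thesis using *[of x z y] assms by (auto simp: mult_ac)
  next
    case 3 then show ?thesis using *[of x y z] assms by (auto simp: mult_ac)
  qed
qed

text \<open>As for three factors, with one more regime: as \<open>k\<close> passes
  \<open>1/4\<close> and \<open>1/3\<close>, the spread-out triple has two, one and then no entries
  equal to \<open>k\<close>, which gives \<open>4 * k * (1 - k)^3\<close>,
  \<open>3 * k * (1 - k)^2\<close> and \<open>2 * k * (1 - k)\<close>.\<close>

lemma product4_ge:
  fixes x y z w :: real
  assumes nn: "0 \<le> x" "0 \<le> y" "0 \<le> z" "0 \<le> w"
    and le: "2 * x + y + z + w \<le> 1" "x + 2 * y + z + w \<le> 1"
      "x + y + 2 * z + w \<le> 1" "x + y + z + 2 * w \<le> 1"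
  shows "(1 - x) * (1 - y) * (1 - z) * (1 - w) \<ge> 256/625"
proof -
  have *: "(1 - k) * ((1 - a) * (1 - b) * (1 - c)) \<ge> 256/625"
    if "0 \<le> a" "0 \<le> b" "0 \<le> c" "a \<le> k" "b \<le> k" "c \<le> k" "2 * k + a + b + c \<le> 1" for a b c k :: real
  proof -
    have k: "0 \<le> k" "k \<le> 1/2" using that by auto
    have p0: "1 - (a + b + c) \<le> (1 - a) * (1 - b) * (1 - c)"
    proof -
      have "0 \<le> a * b + a * c + b * c * (1 - a)"
        using that k by (intro add_nonneg_nonneg mult_nonneg_nonneg) auto
      then show ?thesis by (simp only: algebra_simps, linarith?)
    qed
    have p1: "(1 - k) * (1 - (a + b + c - k)) \<le> (1 - a) * (1 - b) * (1 - c)"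
    proof (cases "a + b \<le> k")
      case True
      have "(1 - (a + b)) * (1 - c) \<le> (1 - a) * (1 - b) * (1 - c)"
        using that k mult_nonneg_nonneg[OF that(1,2)]
        by (intro mult_right_mono) (auto simp: algebra_simps)
      with merge_factors[OF True that(6)] show ?thesis by (simp add: algebra_simps)
    next
      case False
      have "(1 - k) * (1 - (a + b - k)) * (1 - c) \<le> (1 - a) * (1 - b) * (1 - c)"
        using that k merge_factors[OF that(4,5)] by (intro mult_right_mono) auto
      moreover have "0 \<le> (1 - k) * ((a + b - k) * c)"
        using that k False by (intro mult_nonneg_nonneg) auto
      ultimately show ?thesis by (simp only: algebra_simps, linarith?)
    qed
    consider "k \<le> 1/5" | "1/5 \<le> k" "k \<le> 1/4" | "1/4 \<le> k" "k \<le> 1/3" | "1/3 \<le> k" by linarith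
    then show ?thesis
    proof cases
      case 1
      have "(4/5) * ((4/5) * (4/5) * (4/5)) \<le> (1 - k) * ((1 - a) * (1 - b) * (1 - c))"
        using 1 that by (intro mult_mono) auto
      then show ?thesis by simp
    next
      case 2
      have p2: "(1 - k) * ((1 - k) * (4 * k)) \<le> (1 - a) * (1 - b) * (1 - c)"
      proof (cases "a + b + c \<le> 2 * k")
        case True
        have "0 \<le> (1 - k) * k * (2 * k - (a + b + c)) + (1 - k) * (1 - k) * (1 - (a + b + c) + 2 * k - 4 * k)"
          using that k True by (intro add_nonneg_nonneg mult_nonneg_nonneg) auto
        with p1 show ?thesis by (simp only: algebra_simps, linarith?)
      next
        case False
        have "(1 - k) * (1 - k) * (1 - (a + b + c - 2 * k)) \<le> (1 - k) * (1 - (a + b - k)) * (1 - c)"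
          using merge_factors[of "a + b - k" k c] that k
          by (auto simp: mult.assoc intro!: mult_left_mono) (simp add: algebra_simps)
        also have "\<dots> \<le> (1 - a) * (1 - b) * (1 - c)"
          using that k merge_factors[OF that(4,5)] by (intro mult_right_mono) auto
        finally have "(1 - k) * (1 - k) * (1 - (a + b + c - 2 * k)) \<le> (1 - a) * (1 - b) * (1 - c)" .
        moreover have "(1 - k) * (1 - k) * (4 * k) \<le> (1 - k) * (1 - k) * (1 - (a + b + c - 2 * k))"
          using that k by (intro mult_left_mono) auto
        ultimately show ?thesis by (simp only: mult.assoc, linarith?)
      qed
      then have "(1 - k) * ((1 - k) * ((1 - k) * (4 * k))) \<le> (1 - k) * ((1 - a) * (1 - b) * (1 - c))"
        using k by (intro mult_left_mono) auto
      moreover have "256/625 \<le> (1 - k) * ((1 - k) * ((1 - k) * (4 * k)))"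
      proof -
        have "0 \<le> k * (k - 1/5)" "0 \<le> k * ((1/4 - k) * (1/4 + k))" using 2 by (intro mult_nonneg_nonneg; simp)+
        then have "0 \<le> 256/125 - 244/25 * k + 56/5 * (k * k) - 4 * (k * (k * k))"
          using 2 by (simp only: algebra_simps, linarith?)
        then have "0 \<le> (k - 1/5) * (256/125 - 244/25 * k + 56/5 * (k * k) - 4 * (k * (k * k)))"
          using 2 by (intro mult_nonneg_nonneg) auto
        then show ?thesis by (simp only: algebra_simps, linarith?)
      qed
      ultimately show ?thesis by linarith
    next
      case 3
      have "(1 - k) * (3 * k) \<le> (1 - k) * (1 - (a + b + c - k))"
        using 3 that by (intro mult_left_mono) auto
      then have "(1 - k) * (3 * k) \<le> (1 - a) * (1 - b) * (1 - c)" using p1 by linarith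
      then have "(1 - k) * ((1 - k) * (3 * k)) \<le> (1 - k) * ((1 - a) * (1 - b) * (1 - c))"
        using k by (intro mult_left_mono) auto
      moreover have "0 \<le> (k - 1/4) * ((1/3 - k) * (17/12 - k)) + (k - 1/4) * (13/144)"
        using 3 by (intro add_nonneg_nonneg mult_nonneg_nonneg) auto
      ultimately show ?thesis by (simp only: algebra_simps, linarith?)
    next
      case 4
      have "(1 - k) * (2 * k) \<le> (1 - k) * ((1 - a) * (1 - b) * (1 - c))"
        using that k p0 by (intro mult_left_mono) auto
      moreover have "0 \<le> (k - 1/3) * (1/2 - k)" using 4 k by (intro mult_nonneg_nonneg) auto
      ultimately show ?thesis using 4 by (simp only: algebra_simps, linarith?)
    qed
  qed
  consider "y \<le> x \<and> z \<le> x \<and> w \<le> x" | "x \<le> y \<and> z \<le> y \<and> w \<le> y"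
    | "x \<le> z \<and> y \<le> z \<and> w \<le> z" | "x \<le> w \<and> y \<le> w \<and> z \<le> w" by linarith
  then show ?thesis
  proof cases
    case 1 then show ?thesis using *[of y z w x] assms by (auto simp: mult_ac)
  next
    case 2 then show ?thesis using *[of x z w y] assms by (auto simp: mult_ac)
  next
    case 3 then show ?thesis using *[of x y w z] assms by (auto simp: mult_ac)
  next
    case 4 then show ?thesis using *[of x y z w] assms by (auto simp: mult_ac)
  qed
qed

section \<open>The two largest values are heavy together\<close>

lemma balanced_bound:
  fixes e H X Y :: real
  assumes e: "1/2 \<le> e" "e \<le> 1" and H: "0 \<le> H" "H \<le> 1"
    and XY: "0 \<le> Y" "Y \<le> X" "2 * X + Y \<le> 1 + e * (1 - H)"
  shows "H * (X + Y) + (1 - H - H * e) / e * (X * Y) \<le> 5/9"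
\<comment> \<open>In the main use \<open>u + v = 1\<close> and \<open>e = (1 - u) / (1 - v)\<close>;
  \<open>X\<close> and \<open>Y\<close> are then \<open>x\<close> and \<open>e * y\<close> in
  decreasing order, and the left side is the probability of a heavy sum with Markov's bounds
  \<open>H\<close> and \<open>H * e\<close> inserted. Equality occurs at \<open>H = 1\<close>,
  \<open>X = Y = 1/3\<close>.\<close>
proof (rule bilinear_bound[OF XY H(1)])
  have "0 \<le> (1 - H) * (1 - H)" "0 \<le> H * (1 - H) * (1 - e)"
    using e H by (intro mult_nonneg_nonneg; simp)+
  then show "H * (1 + e * (1 - H)) / 2 \<le> 5/9" using H by (simp add: algebra_simps)
  \<comment> \<open>The corner inequality is an equality at \<open>r = 0\<close>; the sign facts
    below are the summands that remain after division by \<open>r\<close>.\<close>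
  define r where "r = 1 - H"
  have r: "0 \<le> r" "r \<le> 1" using H by (auto simp: r_def)
  have "0 \<le> (1 - r) * ((1 - e) * (4 * e - 1))" "0 \<le> (r * (1 - r)) * (e^2 * (1 + e))"
    using e r by (intro mult_nonneg_nonneg; simp)+
  moreover have "0 \<le> r * (3 * e - 1 - e^2)"
  proof -
    have "0 \<le> (e - 1/2) * (1 - e)" using e by (intro mult_nonneg_nonneg) auto
    then have "0 \<le> 3 * e - 1 - e^2" using e by (simp add: field_simps power2_eq_square)
    then show ?thesis using r by simp
  qed
  ultimately have "0 \<le> (1 - r) * ((1 - e) * (4 * e - 1)) + (r * (1 - r)) * (e^2 * (1 + e))
      + r * (3 * e - 1 - e^2)" by linarith
  then have "0 \<le> r * ((1 - r) * ((1 - e) * (4 * e - 1)) + (r * (1 - r)) * (e^2 * (1 + e))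
      + r * (3 * e - 1 - e^2))"
    using r by (intro mult_nonneg_nonneg)
  also have "\<dots> = 5 * e - (6 * e * (1 - r) * (1 + e * r) + (1 - (1 - r) - (1 - r) * e) * (1 + e * r)^2)"
    by (simp add: algebra_simps power2_eq_square)
  finally have "6 * e * H * (1 + e * (1 - H)) + (1 - H - H * e) * (1 + e * (1 - H))^2 \<le> 5 * e"
    by (simp add: r_def)
  then have "(6 * e * H * (1 + e * (1 - H)) + (1 - H - H * e) * (1 + e * (1 - H))^2) / (9 * e) \<le> 5 * e / (9 * e)"
    using e by (intro divide_right_mono) auto
  also have "5 * e / (9 * e) = 5/9" using e by simp
  also have "(6 * e * H * (1 + e * (1 - H)) + (1 - H - H * e) * (1 + e * (1 - H))^2) / (9 * e)
      = 2 * H * (1 + e * (1 - H)) / 3 + (1 - H - H * e) / e * (1 + e * (1 - H))^2 / 9"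
    using e by (simp add: add_divide_distrib)
  finally show "2 * H * (1 + e * (1 - H)) / 3 + (1 - H - H * e) / e * (1 + e * (1 - H))^2 / 9 \<le> 5/9" .
qed

text \<open>\<open>K > 0\<close> forces a negative slope, so enlarging \<open>D\<close> preserves
  the constraint. With \<open>D = 1 - v\<close> and \<open>e * D = 1 - u\<close>, the excluded case
  \<open>K <= 0\<close> is the constraint at \<open>u = v = 1\<close>, which is strong enough by
  itself.\<close>

lemma affine_nonpos_extend:
  fixes K J D E :: real
  assumes "K + D * J \<le> 0" "0 < K" "0 < D" "D \<le> E"
  shows "K + E * J \<le> 0"
proof -
  have "D * J < 0" using assms by linarith
  then have "J < 0" using assms(3) by (simp add: mult_less_0_iff)
  then have "E * J \<le> D * J" using assms(4) by (intro mult_right_mono_neg) auto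
  then show ?thesis using assms(1) by linarith
qed

text \<open>The constraints are affine in \<open>D\<close>, so only its largest admissible value matters: \<open>1 / (1 + e)\<close>
  for \<open>e \<ge> 1/2\<close> and \<open>2/3\<close> for \<open>e < 1/2\<close>.\<close>

lemma two_large_wide:
  fixes x y H e D :: real
  assumes x: "0 \<le> x" "x \<le> 1" and y: "0 \<le> y" "y \<le> 1" and H: "0 \<le> H" "H \<le> 1"
    and e: "1/2 \<le> e" "e \<le> 1" and D: "0 < D" "(1 + e) * D \<le> 1"
    and C1: "2 * (1 - e * D) * x + (1 - D) * y + H * e * D \<le> 1"
    and C2: "(1 - e * D) * x + 2 * (1 - D) * y + H * e * D \<le> 1"
  shows "x * y + H * (x * (1 - y)) + H * e * ((1 - x) * y) \<le> 5/9"
proof -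
  have D': "D \<le> 1 / (1 + e)" using D e by (simp add: field_simps)
  have eq: "x * y + H * (x * (1 - y)) + H * e * ((1 - x) * y)
      = H * (x + e * y) + (1 - H - H * e) / e * (x * (e * y))"
    using e by (simp add: field_simps)
  have eq': "x * y + H * (x * (1 - y)) + H * e * ((1 - x) * y)
      = H * (e * y + x) + (1 - H - H * e) / e * (e * y * x)"
    using e by (simp add: field_simps)
  have ey: "e * y \<le> y" "0 \<le> e * y" using e y by (auto intro: mult_left_le_one_le)
  have up: "x * y + H * (x * (1 - y)) + H * e * ((1 - x) * y) \<le> x + (1 - x) * (e * y)"
  proof -
    have "0 \<le> (1 - H) * (x * (1 - y))" "0 \<le> (1 - H) * ((1 - x) * (e * y))"
      using x y H e by (intro mult_nonneg_nonneg; simp)+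
    then show ?thesis by (simp only: algebra_simps, linarith?)
  qed
  show ?thesis
  proof (cases "e * y \<le> x")
    case k: True
    show ?thesis
    proof (cases "2 * x + y \<le> 1")
      case True
      have "(1 - x) * (e * y) \<le> (1 - x) * min x (1 - 2 * x)"
        using x k ey True by (intro mult_left_mono) auto
      moreover have "x + (1 - x) * min x (1 - 2 * x) \<le> 5/9"
      proof (cases "x \<le> 1/3")
        case True
        have "0 \<le> (1/3 - x) * (5/3 - x)" using True by (intro mult_nonneg_nonneg) auto
        then show ?thesis using True by (simp add: min_def field_simps)
      next
        case False
        have "0 \<le> (x - 1/3) * (2/3 - x)" using False True y by (intro mult_nonneg_nonneg) auto
        then show ?thesis using False by (simp add: min_def field_simps)
      qed
      ultimately show ?thesis using up by linarith
    next
      case False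
      have "(2 * x + y - 1) + D * (H * e - 2 * e * x - y) \<le> 0"
        using C1 by (simp add: algebra_simps)
      \<comment> \<open>\<open>D = 1 / (1 + e)\<close> is the boundary
        \<open>u + v = 1\<close>.\<close>
      then have "(2 * x + y - 1) + 1 / (1 + e) * (H * e - 2 * e * x - y) \<le> 0"
        by (rule affine_nonpos_extend[OF _ _ D(1) D']) (use False in simp)
      then have "2 * x + e * y \<le> 1 + e * (1 - H)" using e by (simp add: field_simps)
      then show ?thesis unfolding eq using e H k ey by (intro balanced_bound) auto
    qed
  next
    case k: False
    show ?thesis
    proof (cases "x + 2 * y \<le> 1")
      case True
      have "(1 - x) * (e * y) \<le> (1 - x) * ((1 - x) / 2)"
        using x k ey True by (intro mult_left_mono) auto
      moreover have "0 \<le> (1/3 - x) * (x + 1/3)" using k ey True x by (intro mult_nonneg_nonneg) auto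
      ultimately show ?thesis using up by (simp add: algebra_simps)
    next
      case False
      have "(x + 2 * y - 1) + D * (H * e - e * x - 2 * y) \<le> 0"
        using C2 by (simp add: algebra_simps)
      then have "(x + 2 * y - 1) + 1 / (1 + e) * (H * e - e * x - 2 * y) \<le> 0"
        by (rule affine_nonpos_extend[OF _ _ D(1) D']) (use False in simp)
      then have "2 * (e * y) + x \<le> 1 + e * (1 - H)" using e by (simp add: field_simps)
      then show ?thesis unfolding eq' using e H k x by (intro balanced_bound) auto
    qed
  qed
qed

lemma two_large_narrow:
  fixes x y H e D :: real
  assumes x: "0 \<le> x" "x \<le> 1" and y: "0 \<le> y" "y \<le> 1" and H: "0 \<le> H" "H \<le> 1"
    and e: "0 \<le> e" "e < 1/2" and D: "0 < D" "D \<le> 2/3"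
    and C1: "2 * (1 - e * D) * x + (1 - D) * y + H * e * D \<le> 1"
    and C2: "(1 - e * D) * x + 2 * (1 - D) * y + H * e * D \<le> 1"
  shows "x * y + H * (x * (1 - y)) + H * e * ((1 - x) * y) \<le> 37/64"
proof -
  let ?P = "x * y + H * (x * (1 - y)) + H * e * ((1 - x) * y)"
  have eq: "x * y + H * (x * (1 - y)) + H * (1/2) * ((1 - x) * y)
      = H * (x + y/2) + (1 - H - H * (1/2)) / (1/2) * (x * (y/2))"
      "x * y + H * (x * (1 - y)) + H * (1/2) * ((1 - x) * y)
      = H * (y/2 + x) + (1 - H - H * (1/2)) / (1/2) * (y/2 * x)"
    by (simp_all add: field_simps)
  have nn: "0 \<le> (1 - x) * y" using x y by simp
  have "0 \<le> (1 - H) * (x * (1 - y))" "0 \<le> (1/2 - e) * (H * ((1 - x) * y))"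
    using x y H e by (intro mult_nonneg_nonneg; simp)+
  then have up: "?P \<le> x + H * e * ((1 - x) * y)"
    and mono: "?P \<le> x * y + H * (x * (1 - y)) + H * (1/2) * ((1 - x) * y)"
    by (simp_all add: field_simps)
  have He: "H * e \<le> 1/2" using mult_mono[of H 1 e "1/2"] H e by simp
  have up2: "?P \<le> x + 1/2 * ((1 - x) * y)"
    using up mult_right_mono[OF He nn] by linarith
  show ?thesis
  proof (cases "y \<le> 2 * x")
    case k: True
    \<comment> \<open>The middle case is the hypothesis of \<open>balanced_bound\<close> at
      \<open>e = 1/2\<close>, to which the probability is raised by monotonicity. If that hypothesis
      fails, the constraint at \<open>D = 2/3\<close>, that is \<open>v = 1/3\<close>, bounds
      \<open>H * e\<close>, and an optimisation over \<open>y\<close> and then \<open>x\<close>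
      remains.\<close>
    consider "2 * x + y \<le> 1" | "2 * x + y > 1" "4 * x + y + H \<le> 3" | "2 * x + y > 1" "4 * x + y + H > 3"
      by linarith
    then show ?thesis
    proof cases
      case 1
      have "(1 - x) * y \<le> (1 - x) * (1 - 2 * x)" using 1 x by (intro mult_left_mono) auto
      moreover have "0 \<le> x * (1/2 - x)" using 1 x y by (intro mult_nonneg_nonneg) auto
      ultimately have "?P \<le> 1/2" using up2 by (simp only: algebra_simps, linarith?)
      then show ?thesis by simp
    next
      case 2
      have "H * (x + y/2) + (1 - H - H * (1/2)) / (1/2) * (x * (y/2)) \<le> 5/9"
        using 2 H k y by (intro balanced_bound) (auto simp: field_simps)
      then show ?thesis using mono eq(1) by linarith
    next
      case 3
      have "(2 * x + y - 1) + D * (H * e - 2 * e * x - y) \<le> 0"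
        using C1 by (simp add: algebra_simps)
      then have "(2 * x + y - 1) + 2/3 * (H * e - 2 * e * x - y) \<le> 0"
        by (rule affine_nonpos_extend[OF _ _ D]) (use 3 in simp)
      then have *: "6 * x + y - 4 * (e * x) + 2 * (H * e) \<le> 3" by (simp add: algebra_simps)
      have "0 < (1 - 2 * e) * (H - 2 * x)" using * 3 by (simp add: algebra_simps)
      then have Hx: "2 * x < H" using e by (simp add: zero_less_mult_iff)
      have "e * x \<le> 1/2 * x" using e x by (intro mult_right_mono) auto
      then have "2 * (H * e) \<le> 3 - 4 * x - y" using * by linarith
      then have "2 * (H * e) * ((1 - x) * y) \<le> (3 - 4 * x - y) * ((1 - x) * y)"
        by (intro mult_right_mono nn)
      moreover have "(3 - 4 * x - y) * y \<le> (3 - 4 * x)^2 / 4"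
        using zero_le_power2[of "3 - 4 * x - 2 * y"] by (simp add: algebra_simps power2_eq_square)
      then have "(1 - x) * ((3 - 4 * x - y) * y) \<le> (1 - x) * ((3 - 4 * x)^2 / 4)"
        using x by (intro mult_left_mono) auto
      moreover have "x + 1/2 * ((1 - x) * ((3 - 4 * x)^2 / 4)) \<le> 37/64"
      proof -
        have "0 \<le> (x - 1/3) * (1/2 - x) * (80/3 - 16 * x) + x / 9 + 5/72"
          using k 3 Hx H by (intro add_nonneg_nonneg mult_nonneg_nonneg) auto
        then show ?thesis by (simp add: field_simps power2_eq_square)
      qed
      ultimately show ?thesis using up by (simp only: algebra_simps, linarith?)
    qed
  next
    case k: False
    \<comment> \<open>The same trichotomy with \<open>x\<close> and \<open>y / 2\<close>
      exchanged.\<close>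
    consider "x + 2 * y \<le> 1" | "x + 2 * y > 1" "2 * x + 2 * y + H \<le> 3" | "x + 2 * y > 1" "2 * x + 2 * y + H > 3"
      by linarith
    then show ?thesis
    proof cases
      case 1
      have "(1 - x) * y \<le> 1 * (1/2)" using 1 x y by (intro mult_mono) auto
      then have "?P \<le> 1/2" using 1 k up2 by linarith
      then show ?thesis by simp
    next
      case 2
      have "H * (y/2 + x) + (1 - H - H * (1/2)) / (1/2) * (y/2 * x) \<le> 5/9"
        using 2 H k x by (intro balanced_bound) (auto simp: field_simps)
      then show ?thesis using mono eq(2) by linarith
    next
      case 3
      have "(x + 2 * y - 1) + D * (H * e - e * x - 2 * y) \<le> 0"
        using C2 by (simp add: algebra_simps)
      then have "(x + 2 * y - 1) + 2/3 * (H * e - e * x - 2 * y) \<le> 0"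
        by (rule affine_nonpos_extend[OF _ _ D]) (use 3 in simp)
      then have *: "3 * x + 2 * y - 2 * (e * x) + 2 * (H * e) \<le> 3" by (simp add: algebra_simps)
      have "e * x \<le> 1/2 * x" using e x by (intro mult_right_mono) auto
      then have "2 * (H * e) \<le> 3 - 2 * x - 2 * y" using * by linarith
      then have 4: "2 * (H * e) * ((1 - x) * y) \<le> (3 - 2 * x - 2 * y) * ((1 - x) * y)"
        by (intro mult_right_mono nn)
      have xy: "1 \<le> x + y" "x \<le> 1/2" using 3 H k y by auto
      show ?thesis
      proof (cases "x \<le> 1/3")
        case True
        have "0 \<le> (x + y - 1) * (2 * y - 1)" using True xy by (intro mult_nonneg_nonneg) auto
        then have "(3 - 2 * x - 2 * y) * y \<le> 1 - x" by (simp only: algebra_simps, linarith?)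
        then have "(1 - x) * ((3 - 2 * x - 2 * y) * y) \<le> (1 - x) * (1 - x)"
          using x by (intro mult_left_mono) auto
        moreover have "x * x \<le> 1/3 * (1/3)" using True x by (intro mult_mono) auto
        ultimately show ?thesis using up 4 by (simp only: algebra_simps, linarith?)
      next
        case False
        have "0 \<le> (y - 2 * x) * (2 * y + 6 * x - 3)" using False k by (intro mult_nonneg_nonneg) auto
        then have "(3 - 2 * x - 2 * y) * y \<le> 6 * x * (1 - 2 * x)" by (simp only: algebra_simps, linarith?)
        then have "(1 - x) * ((3 - 2 * x - 2 * y) * y) \<le> (1 - x) * (6 * x * (1 - 2 * x))"
          using x by (intro mult_left_mono) auto
        moreover have "0 \<le> (x - 1/3) * (x - 1/3) * (5 - 6 * x)"
          using False xy by (intro mult_nonneg_nonneg) auto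
        ultimately show ?thesis using up 4 by (simp only: algebra_simps, linarith?)
      qed
    qed
  qed
qed

text \<open>Since \<open>R >= 1 - u\<close>, Markov's inequality says nothing once \<open>u\<close>
  is attained, so that event counts entirely as heavy. If \<open>y * h\<close> is at most
  \<open>b * (1 - 2 * x)\<close> and \<open>b * (1 - x) / 2\<close>, the worst case is
  \<open>x = 1/3\<close> with value \<open>1/3 + 2/9 * b\<close>; \<open>b = 9/8\<close> and
  \<open>b = 1\<close> give \<open>7/12\<close> and \<open>5/9\<close>.\<close>

lemma two_large_full:
  fixes x y h u v R :: real
  assumes x: "0 \<le> x" "x \<le> 1" and y: "0 \<le> y" and h: "0 \<le> h" "h \<le> 1"
    and uv: "1/3 \<le> v" "v \<le> 1" "v \<le> u" "1 \<le> u + v"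
    and R: "1 - u \<le> R" "(1 - v) * h \<le> R"
    and C1: "2 * u * x + v * y + R \<le> 1" and C2: "u * x + 2 * v * y + R \<le> 1"
  shows "x + (1 - x) * (y * h) \<le> 7/12" and "1/2 \<le> v \<Longrightarrow> x + (1 - x) * (y * h) \<le> 5/9"
proof -
  have ux: "(1 - R) * x \<le> u * x" using R x by (intro mult_right_mono) auto
  have vy: "0 \<le> v * y" using uv y by simp
  have "u * (2 * x) \<le> u * 1" using C1 vy R by linarith
  then have x2: "x \<le> 1/2" using uv by simp
  have "v * y \<le> (1 - R) * (1 - 2 * x)" using C1 ux by (simp add: algebra_simps)
  also have "\<dots> \<le> (1 - (1 - v) * h) * (1 - 2 * x)" using R x2 by (intro mult_right_mono) auto
  finally have 1: "v * y \<le> (1 - (1 - v) * h) * (1 - 2 * x)" .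
  have "2 * (v * y) \<le> (1 - R) * (1 - x)" using C2 ux by (simp add: algebra_simps)
  also have "\<dots> \<le> (1 - (1 - v) * h) * (1 - x)" using R x2 by (intro mult_right_mono) auto
  finally have 2: "2 * (v * y) \<le> (1 - (1 - v) * h) * (1 - x)" .
  \<comment> \<open>\<open>g\<close> will be a majorant of \<open>(1 - (1 - v) * h) / v\<close> that
    is affine in \<open>h\<close> and exact at \<open>h = 1\<close>: \<open>3 - 2 * h\<close> for
    \<open>v >= 1/3\<close> and \<open>2 - h\<close> for \<open>v >= 1/2\<close>. The maxima of
    \<open>g * h\<close> are \<open>9/8\<close> at \<open>h = 3/4\<close> and \<open>1\<close> at
    \<open>h = 1\<close>.\<close>
  have key: "y * h \<le> b * (1 - 2 * x)" "2 * (y * h) \<le> b * (1 - x)"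
    if "1 - (1 - v) * h \<le> v * g" "g * h \<le> b" for g b
  proof -
    have "v * y \<le> (v * g) * (1 - 2 * x)"
      using 1 mult_right_mono[OF that(1), of "1 - 2 * x"] x2 by linarith
    then have "v * y \<le> v * (g * (1 - 2 * x))" by (simp add: mult.assoc)
    then have "y \<le> g * (1 - 2 * x)" using uv by simp
    then have "y * h \<le> g * (1 - 2 * x) * h" using h by (intro mult_right_mono)
    also have "\<dots> = (g * h) * (1 - 2 * x)" by simp
    also have "\<dots> \<le> b * (1 - 2 * x)" using that x2 by (intro mult_right_mono) auto
    finally show "y * h \<le> b * (1 - 2 * x)" .
    have "2 * (v * y) \<le> (v * g) * (1 - x)"
      using 2 mult_right_mono[OF that(1), of "1 - x"] x2 by linarith
    then have "v * (2 * y) \<le> v * (g * (1 - x))" by (simp add: mult.assoc)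
    then have "2 * y \<le> g * (1 - x)" using uv by simp
    then have "2 * y * h \<le> g * (1 - x) * h" using h by (intro mult_right_mono)
    also have "\<dots> = (g * h) * (1 - x)" by simp
    also have "\<dots> \<le> b * (1 - x)" using that x2 by (intro mult_right_mono) auto
    finally show "2 * (y * h) \<le> b * (1 - x)" by simp
  qed
  have fin: "x + (1 - x) * (y * h) \<le> 1/3 + 2/9 * b"
    if yh: "y * h \<le> b * (1 - 2 * x)" "2 * (y * h) \<le> b * (1 - x)" and b: "1 \<le> b" "b \<le> 9/8" for b
  proof (cases "x \<le> 1/3")
    case True
    have "(1 - x) * (2 * (y * h)) \<le> (1 - x) * (b * (1 - x))"
      using yh x by (intro mult_left_mono) auto
    moreover have "0 \<le> (1/3 - x) * (2 - b * (5/3 - x))"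
    proof (rule mult_nonneg_nonneg)
      have "b * (5/3 - x) \<le> 9/8 * (5/3)" using b x x2 by (intro mult_mono) auto
      then show "0 \<le> 2 - b * (5/3 - x)" by linarith
    qed (use True in simp)
    ultimately show ?thesis by (simp add: field_simps)
  next
    case False
    have "(1 - x) * (y * h) \<le> (1 - x) * (b * (1 - 2 * x))"
      using yh x by (intro mult_left_mono) auto
    moreover have "0 \<le> (x - 1/3) * (b * (7/3 - 2 * x) - 1)"
    proof (rule mult_nonneg_nonneg)
      have "1 * 1 \<le> b * (7/3 - 2 * x)" using b x x2 by (intro mult_mono) auto
      then show "0 \<le> b * (7/3 - 2 * x) - 1" by linarith
    qed (use False in simp)
    ultimately show ?thesis by (simp add: field_simps)
  qed
  show "x + (1 - x) * (y * h) \<le> 7/12"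
  proof -
    have "0 \<le> (3 * v - 1) * (1 - h)" using uv h by (intro mult_nonneg_nonneg) auto
    then have a: "1 - (1 - v) * h \<le> v * (3 - 2 * h)" by (simp add: algebra_simps)
    have b: "(3 - 2 * h) * h \<le> 9/8"
      using zero_le_power2[of "h - 3/4"] by (simp add: field_simps power2_eq_square)
    from fin[OF key[OF a b]] show ?thesis by simp
  qed
  show "x + (1 - x) * (y * h) \<le> 5/9" if "1/2 \<le> v"
  proof -
    have "0 \<le> (2 * v - 1) * (1 - h)" using that h by (intro mult_nonneg_nonneg) auto
    then have a: "1 - (1 - v) * h \<le> v * (2 - h)" by (simp add: algebra_simps)
    have b: "(2 - h) * h \<le> 1"
      using zero_le_power2[of "h - 1"] by (simp add: algebra_simps power2_eq_square)
    from fin[OF key[OF a b]] show ?thesis by simp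
  qed
qed

text \<open>The case in which the two largest values \<open>u \<ge> v\<close> are together heavy. They are attained with
  probabilities \<open>x\<close> and \<open>y\<close>, the other variables have total mean \<open>R\<close>, and \<open>g\<close>, \<open>h\<close> are the conditional
  probabilities of a heavy sum if only \<open>u\<close>, only \<open>v\<close> is attained; Markov's inequality relates them
  to \<open>R\<close>.\<close>

lemma two_large_bound:
  fixes x y g h u v R :: real
  assumes x: "0 \<le> x" "x \<le> 1" and y: "0 \<le> y" "y \<le> 1" and g: "0 \<le> g" "g \<le> 1" and h: "0 \<le> h" "h \<le> 1"
    and uv: "1/3 \<le> v" "v \<le> u" "1 \<le> u + v"
    and R: "0 \<le> R" "(1 - u) * g \<le> R" "(1 - v) * h \<le> R"
    and C1: "2 * u * x + v * y + R \<le> 1" and C2: "u * x + 2 * v * y + R \<le> 1"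
  shows "x * y + x * (1 - y) * g + (1 - x) * y * h \<le> 7/12"
    and "1/2 \<le> v \<Longrightarrow> x * y + x * (1 - y) * g + (1 - x) * y * h \<le> 37/64"
proof -
  let ?P = "x * y + x * (1 - y) * g + (1 - x) * y * h"
  have "?P \<le> 7/12 \<and> (1/2 \<le> v \<longrightarrow> ?P \<le> 37/64)"
  proof (cases "1 \<le> v")
    case True
    have "1 * x \<le> u * x" "1 * y \<le> v * y" using True uv x y by (intro mult_right_mono; simp)+
    then have "(1 - x) * (1 - y) \<ge> 4/9" using x y C1 C2 R by (intro product2_ge) auto
    moreover have "0 \<le> x * (1 - y) * (1 - g)" "0 \<le> (1 - x) * y * (1 - h)"
      using x y g h by (intro mult_nonneg_nonneg; simp)+
    ultimately have "?P \<le> 5/9" by (simp add: algebra_simps)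
    then show ?thesis by linarith
  next
    case v: False
    show ?thesis
    proof (cases "1 - u \<le> R")
      case True
      have "0 \<le> x * (1 - y) * (1 - g)" using x y g by (intro mult_nonneg_nonneg) auto
      then have "?P \<le> x + (1 - x) * (y * h)" by (simp add: algebra_simps)
      moreover note two_large_full[OF x y(1) h uv(1) _ uv(2,3) True R(3) C1 C2]
      ultimately show ?thesis using v by force
    next
      case False
      \<comment> \<open>\<open>H = R / (1 - u)\<close> and \<open>H * e = R / (1 - v)\<close> are
        Markov's bounds for \<open>g\<close> and \<open>h\<close>; inserting them only raises the
        probability.\<close>
      define e where "e = (1 - u) / (1 - v)"
      define H where "H = R / (1 - u)"
      have e: "0 < e" "e \<le> 1" "e * (1 - v) = 1 - u"
        using uv v False R by (auto simp: e_def field_simps)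
      have H: "0 \<le> H" "H \<le> 1" "H * (1 - u) = R"
        using uv v False R by (auto simp: H_def field_simps)
      have HeD: "H * e * (1 - v) = R" using e H by (simp add: mult.assoc)
      then have "H * e = R / (1 - v)" using v by (metis eq_divide_imp diff_gt_0_iff_gt less_irrefl not_le)
      moreover have "h \<le> R / (1 - v)" using R v by (simp add: field_simps)
      ultimately have hH: "h \<le> H * e" by simp
      have gH: "g \<le> H" using R False by (simp add: H_def field_simps)
      have "x * (1 - y) * g \<le> x * (1 - y) * H" "(1 - x) * y * h \<le> (1 - x) * y * (H * e)"
        using x y gH hH by (intro mult_left_mono; simp)+
      then have P: "?P \<le> x * y + H * (x * (1 - y)) + H * e * ((1 - x) * y)" by (simp add: mult_ac)
      have "\<dots> \<le> 37/64"
      proof (cases "1/2 \<le> e")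
        case True
        have "x * y + H * (x * (1 - y)) + H * e * ((1 - x) * y) \<le> 5/9"
          by (rule two_large_wide[where D = "1 - v"])
             (use x y H e True HeD v uv C1 C2 in \<open>auto simp: distrib_right\<close>)
        then show ?thesis by simp
      next
        case False
        show ?thesis
          by (rule two_large_narrow[where D = "1 - v"])
             (use x y H e False HeD v uv C1 C2 in auto)
      qed
      then show ?thesis using P by linarith
    qed
  qed
  then show "?P \<le> 7/12" and "1/2 \<le> v \<Longrightarrow> ?P \<le> 37/64" by auto
qed

section \<open>Heavy triples, stars and the full quadruple\<close>

lemma three_of_four_bound:
  fixes x y p q :: real
  assumes y: "0 \<le> y" "y \<le> x" and pq: "0 \<le> p" "p \<le> 1" "0 \<le> q" "q \<le> 1"
    and le: "2 * x + y + p + q \<le> 3"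
  shows "x * y * (p + q - p * q) + (x * (1 - y) + (1 - x) * y) * (p * q) \<le> 5/9"
proof -
  define t where "t = (p + q) / 2"
  have t: "0 \<le> t" "t \<le> 1" "p + q = 2 * t" using pq by (auto simp: t_def)
  have cubic: "w^2 * (3 - 2 * w) \<le> 1" if "0 \<le> w" for w :: real
  proof -
    have "0 \<le> (1 - w)^2 * (1 + 2 * w)" using that by simp
    then show ?thesis by (simp add: algebra_simps power2_eq_square)
  qed
  \<comment> \<open>The left side is the probability that at least three of four independent events
    occur. It depends on \<open>p\<close> and \<open>q\<close> only through \<open>p + q\<close> and
    \<open>p * q\<close>; according to the sign of its coefficient, the product is dropped or
    replaced by \<open>t^2\<close>.\<close>
  have eq: "x * y * (p + q - p * q) + (x * (1 - y) + (1 - x) * y) * (p * q)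
      = 2 * t * (x * y) + (x + y - 3 * (x * y)) * (p * q)"
    by (simp add: t_def field_simps)
  show ?thesis
  proof (cases "x + y - 3 * (x * y) \<le> 0")
    case True
    define w where "w = (2 * x + y) / 2"
    have w: "0 \<le> w" "2 * t \<le> 3 - 2 * w" using y le t by (auto simp: w_def field_simps)
    have "2 * (x * y) \<le> w^2"
      using zero_le_power2[of "2 * x - y"] by (simp add: w_def field_simps power2_eq_square)
    then have "2 * (x * y) * (2 * t) \<le> w^2 * (3 - 2 * w)"
      using w t y by (intro mult_mono) auto
    then have "2 * t * (x * y) \<le> 1/2" using cubic[OF w(1)] by (simp add: mult_ac)
    moreover have "(x + y - 3 * (x * y)) * (p * q) \<le> 0"
      using True pq by (intro mult_nonpos_nonneg) auto
    ultimately show ?thesis unfolding eq by linarith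
  next
    case False
    have "p * q \<le> t^2"
      using zero_le_power2[of "p - q"] by (simp add: t_def field_simps power2_eq_square)
    then have "(x + y - 3 * (x * y)) * (p * q) \<le> (x + y - 3 * (x * y)) * t^2"
      using False by (intro mult_left_mono) auto
    also have "2 * t * (x * y) + (x + y - 3 * (x * y)) * t^2 = t^2 * (x + y) + (2 * t - 3 * t^2) * (x * y)"
      by (simp add: algebra_simps)
    also have "\<dots> \<le> 5/9"
    proof (rule bilinear_bound[OF y])
      show "2 * x + y \<le> 3 - 2 * t" using le t by simp
      show "t^2 * (3 - 2 * t) / 2 \<le> 5/9" using cubic[OF t(1)] by simp
      have "0 \<le> (1 - t)^2 * (11/3 + 12 * (t - 1/3)^2)" by (intro mult_nonneg_nonneg add_nonneg_nonneg) auto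
      then show "2 * t^2 * (3 - 2 * t) / 3 + (2 * t - 3 * t^2) * (3 - 2 * t)^2 / 9 \<le> 5/9"
        by (simp add: field_simps power2_eq_square)
    qed simp
    finally show ?thesis unfolding eq by linarith
  qed
qed

text \<open>At \<open>u = 1/3\<close> the left side is maximal at \<open>p = 3/4\<close>, with value
  \<open>3/8 = 9/16 * 2/3\<close>. Both sides are affine in \<open>u\<close>, and the left one falls
  faster because \<open>2 * p^2 > 9/16\<close>.\<close>

lemma star_bound:
  fixes u p :: real
  assumes "1/3 \<le> u" "9/16 \<le> p"
  shows "p * (1 - 2 * u * p) \<le> 9/16 * (1 - u)"
proof -
  have "(9/16) * (9/16) \<le> p * p" using assms by (intro mult_mono) auto
  then have "0 \<le> (u - 1/3) * (2 * (p * p) - 9/16)" using assms by (intro mult_nonneg_nonneg) auto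
  then show ?thesis using zero_le_power2[of "p - 3/4"] by (simp add: field_simps power2_eq_square)
qed

text \<open>Let \<open>M\<close> be the total mean. Each constraint bounds one mean by
  \<open>1 - M\<close>; multiplying by the odds \<open>f z = (1 - z) / z\<close> and summing gives
  \<open>1 - M <= (1 - M) * (f p + f q + f r + f s)\<close>. A product above \<open>1/2\<close>
  would make the product of the \<open>1 + f z\<close> less than 2, hence the sum of the odds less
  than 1.\<close>

lemma all_four_bound:
  fixes p q r s a b c d :: real
  assumes p: "0 \<le> p" "p \<le> 1" "0 \<le> q" "q \<le> 1" "0 \<le> r" "r \<le> 1" "0 \<le> s" "s \<le> 1"
    and sum: "1 \<le> a + b + c + d"
    and le: "2 * a * p + b * q + c * r + d * s \<le> 1" "a * p + 2 * b * q + c * r + d * s \<le> 1"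
      "a * p + b * q + 2 * c * r + d * s \<le> 1" "a * p + b * q + c * r + 2 * d * s \<le> 1"
  shows "p * q * r * s \<le> 1/2"
proof (rule ccontr)
  assume "\<not> ?thesis"
  then have gt: "1/2 < p * q * r * s" by simp
  then have pos: "0 < p" "0 < q" "0 < r" "0 < s"
    using p by (auto simp: less_le)
  define f where "f z = (1 - z) / z" for z :: real
  have f: "0 \<le> f z" "z * (1 + f z) = 1" "z * f z = 1 - z" if "0 < z" "z \<le> 1" for z
    using that by (auto simp: f_def field_simps)
  note fp = f[OF pos(1) p(2)] and fq = f[OF pos(2) p(4)] and fr = f[OF pos(3) p(6)] and fs = f[OF pos(4) p(8)]
  define M where "M = a * p + b * q + c * r + d * s"
  have "1 + (f p + f q + f r + f s) \<le> (1 + f p) * (1 + f q) * (1 + f r) * (1 + f s)"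
  proof -
    have "1 + (f p + f q) \<le> (1 + f p) * (1 + f q)" using fp fq by (simp add: algebra_simps)
    moreover have "1 + (f r + f s) \<le> (1 + f r) * (1 + f s)" using fr fs by (simp add: algebra_simps)
    ultimately have "(1 + (f p + f q)) * (1 + (f r + f s)) \<le> (1 + f p) * (1 + f q) * ((1 + f r) * (1 + f s))"
      using fp fq fr fs by (intro mult_mono) auto
    moreover have "0 \<le> (f p + f q) * (f r + f s)" using fp fq fr fs by (intro mult_nonneg_nonneg) auto
    ultimately show ?thesis by (simp only: algebra_simps, linarith?)
  qed
  moreover have "(p * q * r * s) * ((1 + f p) * (1 + f q) * (1 + f r) * (1 + f s)) =
      (p * (1 + f p)) * (q * (1 + f q)) * (r * (1 + f r)) * (s * (1 + f s))" by (simp only: mult_ac)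
  then have "(p * q * r * s) * ((1 + f p) * (1 + f q) * (1 + f r) * (1 + f s)) = 1"
    using fp fq fr fs by simp
  moreover have "0 < (p * q * r * s - 1/2) * ((1 + f p) * (1 + f q) * (1 + f r) * (1 + f s))"
    using gt fp fq fr fs by (intro mult_pos_pos) auto
  ultimately have F: "f p + f q + f r + f s < 1"
    by (simp only: left_diff_distrib, linarith?)
  have "a * p * f p \<le> (1 - M) * f p" "b * q * f q \<le> (1 - M) * f q"
    "c * r * f r \<le> (1 - M) * f r" "d * s * f s \<le> (1 - M) * f s"
    using le fp fq fr fs by (intro mult_right_mono; simp add: M_def)+
  then have "a - a * p \<le> (1 - M) * f p" "b - b * q \<le> (1 - M) * f q"
    "c - c * r \<le> (1 - M) * f r" "d - d * s \<le> (1 - M) * f s"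
    using fp(3) fq(3) fr(3) fs(3) by (simp_all add: mult.assoc right_diff_distrib)
  then have 1: "1 - M \<le> (1 - M) * (f p + f q + f r + f s)"
    using sum by (simp add: M_def distrib_left)
  have "M < 1"
  proof (rule ccontr)
    assume "\<not> M < 1"
    then have "a * p \<le> 0" "b * q \<le> 0" "c * r \<le> 0" "d * s \<le> 0" using le by (auto simp: M_def)
    then have "M \<le> 0" by (simp add: M_def)
    with \<open>\<not> M < 1\<close> show False by simp
  qed
  then have "(1 - M) * (f p + f q + f r + f s) < (1 - M) * 1" using F by (intro mult_strict_left_mono) auto
  with 1 show False by simp
qed

text \<open>The following five lemmas serve the case in which all pairs of values are heavy. Among the three
  largest values none (first lemma), one (next two) or two (last two) are heavy on their own.\<close>

lemma at_most_one_of_three_light: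
  fixes k p r t :: real
  assumes p: "0 \<le> p" "p \<le> k" and r: "0 \<le> r" "r \<le> k" and k: "k \<le> 1"
    and t: "t = 2 * k + p + r - 1" "0 \<le> t" "t \<le> 1"
  shows "(1 - k) * (1 - p) * (1 - r)
      + t * (k * (1 - p) * (1 - r) + (1 - k) * p * (1 - r) + (1 - k) * (1 - p) * r) \<ge> 27/64"
    (is "?g \<ge> _")
proof -
  define c where "c = 1 - k"
  define S where "S = p + r"
  have k0: "0 \<le> k" using p by simp
  have S: "0 \<le> S" "S \<le> 2 * k" "t = 2 * k + S - 1" using p r t by (auto simp: S_def)
  \<comment> \<open>For fixed \<open>k\<close> and \<open>S\<close> the expression is affine in
    \<open>p * r\<close> with slope \<open>K\<close>. As \<open>K >= 0\<close>, \<open>p * r\<close>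
    may be replaced by its lower bound, \<open>k * (S - k)\<close> if \<open>S >= k\<close> and 0
    otherwise.\<close>
  define K where "K = c + t - 3 * c * t"
  have eq: "?g = (1 - S + p * r) * K + t * c * (2 - S)"
    by (simp add: K_def c_def S_def algebra_simps)
  have K: "0 \<le> K"
  proof -
    have "0 \<le> (3 - t - 4 * c) * t + 3 * c * (1 - t)^2"
      using S k t by (intro add_nonneg_nonneg mult_nonneg_nonneg) (auto simp: c_def)
    also have "\<dots> = (3 - t) * K" by (simp add: K_def algebra_simps power2_eq_square)
    finally show ?thesis using t by (simp add: zero_le_mult_iff)
  qed
  have poly: "27/64 \<le> (1 - k) * (1 - 3 * k + 6 * k * k)" if "k \<le> 5/6"
  proof -
    have "0 \<le> (k - 1/3)^2 * (5 - 6 * k)" using that by (intro mult_nonneg_nonneg) auto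
    then show ?thesis by (simp add: field_simps power2_eq_square)
  qed
  show ?thesis
  proof (cases "k \<le> S")
    case True
    define w where "w = S - k"
    have w: "0 \<le> w" "w \<le> k" "t = 3 * k + w - 1" using True S by (auto simp: w_def)
    have "0 \<le> (k - p) * (k - r)" using p r by (intro mult_nonneg_nonneg) auto
    then have "(1 - k) * (1 - w) \<le> 1 - S + p * r" by (simp add: w_def S_def algebra_simps)
    then have "(1 - k) * (1 - w) * K \<le> (1 - S + p * r) * K" using K by (intro mult_right_mono)
    moreover have "(1 - k) * (1 - w) * K + t * c * (2 - S)
        = (1 - k) * (1 - 3 * k + 6 * k * k + (3 * k - 1) * (w * (2 - 3 * k - w)))"
      unfolding K_def c_def S(3) w_def by (simp add: algebra_simps)
    ultimately have g: "(1 - k) * (1 - 3 * k + 6 * k * k + (3 * k - 1) * (w * (2 - 3 * k - w))) \<le> ?g"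
      unfolding eq by linarith
    show ?thesis
    proof (cases "1/3 \<le> k")
      case True
      have "0 \<le> (1 - k) * ((3 * k - 1) * (w * (2 - 3 * k - w)))"
        using True k w t by (intro mult_nonneg_nonneg) auto
      moreover have "27/64 \<le> (1 - k) * (1 - 3 * k + 6 * k * k)" using w t by (intro poly) auto
      ultimately show ?thesis using g by (simp only: distrib_left, linarith?)
    next
      case False
      have "0 \<le> (1 - k) * ((1 - 3 * k) * ((k - w) * (2 - 4 * k - w)))"
        using False k w by (intro mult_nonneg_nonneg) auto
      moreover have "0 \<le> (k - 1/4)^2 * (12 * k * k + (37/4 - 22 * k))"
        using False k0 by (intro mult_nonneg_nonneg add_nonneg_nonneg) auto
      ultimately show ?thesis using g by (simp add: field_simps power2_eq_square)
    qed
  next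
    case False
    have "1 - S \<le> 1 - S + p * r" using p r by simp
    then have "(1 - S) * K \<le> (1 - S + p * r) * K" using K by (intro mult_right_mono)
    moreover have "(1 - S) * K + t * c * (2 - S) = 2 * k * (1 - k) - (1 - 2 * k) * (t * (2 * k - t))"
      unfolding K_def c_def S(3) by (simp add: algebra_simps)
    ultimately have g: "2 * k * (1 - k) - (1 - 2 * k) * (t * (2 * k - t)) \<le> ?g"
      unfolding eq by linarith
    show ?thesis
    proof (cases "k \<le> 1/2")
      case True
      have "0 \<le> (1 - 2 * k) * ((3 * k - 1 - t) * (1 - k - t))"
        using True False S t by (intro mult_nonneg_nonneg) auto
      then show ?thesis using g poly True by (simp add: algebra_simps)
    next
      case False
      have "0 \<le> (2 * k - 1) * ((t - (2 * k - 1)) * (1 - t))"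
        using False S t by (intro mult_nonneg_nonneg) auto
      moreover have "0 \<le> (2 * k - 1)^2" by simp
      ultimately show ?thesis using g by (simp add: algebra_simps power2_eq_square)
    qed
  qed
qed

text \<open>\<open>z\<close> is the probability of the value that is heavy alone. A light sum means
  that it is avoided and that at most one of the other three is attained. Here \<open>z\<close> is
  at least \<open>p\<close> and \<open>q\<close>; beyond \<open>z = 1/4\<close> a union bound over
  pairs suffices.\<close>

lemma one_forced_first:
  fixes z p q r :: real
  assumes p: "0 \<le> p" "p \<le> z" and q: "0 \<le> q" "q \<le> z" and r: "0 \<le> r" "r \<le> 1"
    and le: "4 * z + p + q + r \<le> 2"
  shows "(1 - z) * (1 - (p * q + (p + q - 2 * (p * q)) * r)) \<ge> 27/64"
proof (cases "z \<le> 1/4")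
  case True
  have "0 \<le> (p + q - 2 * (p * q)) * (1 - r)"
  proof -
    have "p * q \<le> p * 1" "p * q \<le> 1 * q" using p q True by (intro mult_mono; simp)+
    then show ?thesis using r by (intro mult_nonneg_nonneg) auto
  qed
  then have "(1 - p) * (1 - q) \<le> 1 - (p * q + (p + q - 2 * (p * q)) * r)" by (simp add: algebra_simps)
  moreover have "(3/4) * (3/4) \<le> (1 - p) * (1 - q)" using p q True by (intro mult_mono) auto
  ultimately have "(3/4) * ((3/4) * (3/4)) \<le> (1 - z) * (1 - (p * q + (p + q - 2 * (p * q)) * r))"
    using True by (intro mult_mono) auto
  then show ?thesis by simp
next
  case False
  have z: "1/4 \<le> z" "z \<le> 1/2" using False le p q r by auto
  have "p * q + (p + q - 2 * (p * q)) * r \<le> p * q + p * r + q * r"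
    using p q r by (simp add: algebra_simps)
  also have "\<dots> \<le> (p + q + r)^2 / 3"
    using zero_le_power2[of "p - q"] zero_le_power2[of "p - r"] zero_le_power2[of "q - r"]
    by (simp add: field_simps power2_eq_square)
  also have "\<dots> \<le> (2 - 4 * z)^2 / 3"
    using p q r le by (intro divide_right_mono power_mono) auto
  finally have "(1 - z) * (1 - (2 - 4 * z)^2 / 3) \<le> (1 - z) * (1 - (p * q + (p + q - 2 * (p * q)) * r))"
    using z by (intro mult_left_mono) auto
  moreover have "0 \<le> (1 - 2 * z) * (3/8 - (1 - z) * (1 - 2 * z))"
  proof -
    have "(1 - z) * (1 - 2 * z) \<le> (3/4) * (1/2)" using z by (intro mult_mono) auto
    then show ?thesis using z by (intro mult_nonneg_nonneg) auto
  qed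
  then have "1/2 \<le> (1 - z) * (1 - (2 - 4 * z)^2 / 3)" by (simp add: field_simps power2_eq_square)
  ultimately show ?thesis by linarith
qed

lemma one_forced_other:
  fixes z X Y h :: real
  assumes z: "0 \<le> z" "z \<le> X" and Y: "0 \<le> Y" "Y \<le> X" and h: "0 \<le> h" "h \<le> 1"
    and le: "2 * z + 2 * X + Y + h \<le> 2"
  shows "(1 - z) * (1 - (X * Y + (X + Y - 2 * (X * Y)) * h)) \<ge> 256/625"
proof -
  have z2: "z \<le> 1/2" using assms by simp
  define N where "N = 2 - 2 * z - h"
  have N: "2 * X + Y \<le> N" "0 \<le> N" "1 \<le> N + h" "N + h \<le> 2" "z = 1 - (N + h) / 2"
    using assms z2 by (auto simp: N_def field_simps)
  \<comment> \<open>A majorant affine in \<open>z\<close>. At \<open>z = 1/2\<close> the final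
    product needs a slope of about \<open>3/4\<close>; \<open>77/100\<close> leaves room there and
    in the corner estimate.\<close>
  define b where "b = 5/9 - 77/100 * z"
  have "h * (X + Y) + (1 - 2 * h) * (X * Y) \<le> b"
  proof (rule bilinear_bound[OF Y N(1) h(1)])
    have "0 \<le> (1 - z - h)^2" "0 \<le> z * (1/2 - z)" using z z2 by (auto intro: mult_nonneg_nonneg)
    then show "h * N / 2 \<le> b" using z2 by (simp add: N_def b_def field_simps power2_eq_square)
    \<comment> \<open>\<open>f h\<close> is nine times the defect at the corner
      \<open>(N/3, N/3)\<close>, with \<open>z\<close> expressed through \<open>N + h\<close>. It is
      affine in \<open>h\<close>, so it is checked at the ends of the range given by
      \<open>0 <= h <= 1\<close> and \<open>1 <= N + h <= 2\<close>.\<close>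
    define f where "f y = 6 * y * N + N^2 - 2 * y * N^2 - 693/200 * (N + y) + 193/100" for y
    have "f h \<le> 0"
    proof (cases "N \<le> 1")
      case True
      have "0 \<le> (1 - N) * (307/200 - N)" using True by (intro mult_nonneg_nonneg) auto
      then have f1: "f 1 \<le> 0" by (simp add: f_def field_simps power2_eq_square)
      have "0 \<le> (N - 17/30)^2 * (71/30 - N)" using True by (intro mult_nonneg_nonneg) auto
      then have f2: "f (1 - N) \<le> 0" using N True by (simp add: f_def field_simps power2_eq_square)
      have "N * f h = (1 - h) * f (1 - N) + (h - (1 - N)) * f 1"
        by (simp add: f_def field_simps power2_eq_square)
      also have "\<dots> \<le> 0"
        using f1 f2 h N by (intro add_nonpos_nonpos mult_nonneg_nonpos) auto
      finally have "N * f h \<le> 0" .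
      show ?thesis
      proof (cases "N = 0")
        case True then show ?thesis using h N by (simp add: f_def)
      next
        case False
        with \<open>N * f h \<le> 0\<close> N(2) show ?thesis by (simp add: mult_le_0_iff)
      qed
    next
      case False
      have "0 \<le> (N - 1) * (2 - N)" using False N h by (intro mult_nonneg_nonneg) auto
      then have f1: "f 0 \<le> 0" using False by (simp add: f_def field_simps power2_eq_square)
      have "0 \<le> (N - 1)^2 * (5 - 2 * N)" using N h by (intro mult_nonneg_nonneg) auto
      then have f2: "f (2 - N) \<le> 0" by (simp add: f_def field_simps power2_eq_square)
      have "(2 - N) * f h = (2 - N - h) * f 0 + h * f (2 - N)"
        by (simp add: f_def field_simps power2_eq_square)
      also have "\<dots> \<le> 0"
        using f1 f2 h N by (intro add_nonpos_nonpos mult_nonneg_nonpos) auto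
      finally have "(2 - N) * f h \<le> 0" .
      show ?thesis
      proof (cases "N = 2")
        case True then show ?thesis using h N by (simp add: f_def)
      next
        case False
        with \<open>(2 - N) * f h \<le> 0\<close> N h show ?thesis by (simp add: mult_le_0_iff)
      qed
    qed
    then show "2 * h * N / 3 + (1 - 2 * h) * N^2 / 9 \<le> b"
      unfolding b_def N(5) by (simp add: f_def field_simps power2_eq_square)
  qed
  then have "(1 - z) * (1 - b) \<le> (1 - z) * (1 - (X * Y + (X + Y - 2 * (X * Y)) * h))"
    using z2 by (intro mult_left_mono) (auto simp: algebra_simps)
  moreover have "0 \<le> z * (1/2 - z)" using z z2 by (intro mult_nonneg_nonneg) auto
  then have "256/625 \<le> (1 - z) * (1 - b)" using z2 by (simp add: b_def field_simps)
  ultimately show ?thesis by linarith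
qed

text \<open>\<open>z\<close> and \<open>y\<close> belong to values that are heavy alone; without
  them a heavy sum needs both \<open>p\<close> and \<open>q\<close>. With
  \<open>a = 1 - 2 * z - y\<close>, the means inequality gives \<open>p * q <= a^2\<close>, and
  \<open>1 - a^2 = (2 * z + y) * (1 + a)\<close> supplies a factor \<open>2 * z\<close>.\<close>

lemma two_forced_first:
  fixes z y p q :: real
  assumes y: "0 \<le> y" "y \<le> z" and p: "0 \<le> p" "p \<le> z" and q: "0 \<le> q" "q \<le> 1"
    and le: "4 * z + 2 * y + p + q \<le> 2"
  shows "(1 - z) * (1 - y) * (1 - p * q) \<ge> 27/64"
proof -
  have z: "0 \<le> z" "z \<le> 1/2" using assms by auto
  consider "z \<le> 1/4" | "1/4 \<le> z" "z \<le> 1/3" | "1/3 \<le> z" by linarith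
  then show ?thesis
  proof cases
    case 1
    have "p * q \<le> z * 1" using p q z by (intro mult_mono) auto
    then have "(3/4) * (3/4) * (3/4) \<le> (1 - z) * (1 - y) * (1 - p * q)"
      using 1 y by (intro mult_mono) auto
    then show ?thesis by simp
  next
    define a where "a = 1 - 2 * z - y"
    have a: "0 \<le> a" "1 - 3 * z \<le> a" "a \<le> 1" using assms z by (auto simp: a_def)
    have "p * q \<le> ((p + q) / 2)^2"
      using zero_le_power2[of "p - q"] by (simp add: field_simps power2_eq_square)
    also have "\<dots> \<le> a^2" using p q le by (intro power_mono) (auto simp: a_def field_simps)
    finally have pq: "1 - a^2 \<le> 1 - p * q" by simp
    have "2 * z \<le> (1 - y) * (2 * z + y)"
      using mult_nonneg_nonneg[OF y(1) a(1)] by (simp add: a_def algebra_simps)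
    then have "2 * z * (1 + a) \<le> (1 - y) * (2 * z + y) * (1 + a)" using a by (intro mult_right_mono) auto
    also have "\<dots> = (1 - y) * (1 - a^2)" by (simp add: a_def algebra_simps power2_eq_square)
    also have "\<dots> \<le> (1 - y) * (1 - p * q)" using pq y z by (intro mult_left_mono) auto
    finally have "(1 - z) * (2 * z * (1 + a)) \<le> (1 - z) * ((1 - y) * (1 - p * q))"
      using z by (intro mult_left_mono) auto
    then have *: "2 * z * (1 - z) * (1 + a) \<le> (1 - z) * (1 - y) * (1 - p * q)" by (simp only: mult_ac)
    {
      case 2
      have "2 * z * (1 - z) * (2 - 3 * z) \<le> 2 * z * (1 - z) * (1 + a)"
        using a z by (intro mult_left_mono) auto
      moreover have "0 \<le> (1/3 - z) * ((6 * z - 4/3) + 6 * (z * (1/3 - z)))"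
        using 2 by (intro add_nonneg_nonneg mult_nonneg_nonneg) auto
      then have "27/64 \<le> 2 * z * (1 - z) * (2 - 3 * z)" by (simp add: field_simps)
      ultimately show ?thesis using * by linarith
    next
      case 3
      have "2 * z * (1 - z) * 1 \<le> 2 * z * (1 - z) * (1 + a)"
        using a z by (intro mult_left_mono) auto
      moreover have "0 \<le> (z - 1/3) * (2/3 - z)" using 3 z by (intro mult_nonneg_nonneg) auto
      then have "27/64 \<le> 2 * z * (1 - z)" by (simp add: field_simps)
      ultimately show ?thesis using * by linarith
    }
  qed
qed

lemma two_forced_other:
  fixes z y p q :: real
  assumes z: "0 \<le> z" "z \<le> p" and y: "0 \<le> y" "y \<le> p" and q: "0 \<le> q" "q \<le> 1"
    and le: "z + y + p + q / 2 \<le> 1"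
  shows "(1 - z) * (1 - y) * (1 - p * q) \<ge> 256/625"
proof -
  \<comment> \<open>\<open>a\<close> is the slack, so \<open>q <= 2 * a\<close>. The factor
    \<open>(1 - z) * (1 - y)\<close> is at least \<open>p + a\<close>, and also at least
    \<open>(1 - p) * (2 * p + a)\<close> because \<open>z\<close> and \<open>y\<close> are capped by
    \<open>p\<close>. The numerical ranges decide which bound to use.\<close>
  define a where "a = 1 - z - y - p"
  have a: "0 \<le> a" "a \<le> 1 - p" "1 - 3 * p \<le> a" and p: "0 \<le> p" "p \<le> 1" using assms by (auto simp: a_def)
  have "p * q \<le> p * (2 * a)" using p le by (intro mult_left_mono) (auto simp: a_def)
  then have pq: "1 - 2 * p * a \<le> 1 - p * q" by simp
  have "p * a \<le> p * (1 - p)" using a p by (intro mult_left_mono) auto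
  moreover have "p * (1 - p) \<le> 1/4" using zero_le_power2[of "p - 1/2"] by (simp add: field_simps power2_eq_square)
  ultimately have pa: "0 \<le> 1 - 2 * p * a" by simp
  have zy: "0 \<le> (1 - z) * (1 - y)" using assms by (intro mult_nonneg_nonneg) auto
  have low: "m * (1 - 2 * p * a) \<le> (1 - z) * (1 - y) * (1 - p * q)" if "m \<le> (1 - z) * (1 - y)" for m
  proof -
    have "m * (1 - 2 * p * a) \<le> (1 - z) * (1 - y) * (1 - 2 * p * a)"
      using that pa by (intro mult_right_mono)
    also have "\<dots> \<le> (1 - z) * (1 - y) * (1 - p * q)" using pq zy by (intro mult_left_mono)
    finally show ?thesis .
  qed
  have low1: "(p + a) * (1 - 2 * p * a) \<le> (1 - z) * (1 - y) * (1 - p * q)"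
    using mult_nonneg_nonneg[OF z(1) y(1)] by (intro low) (simp add: a_def algebra_simps)
  have low2: "(1 - p) * (2 * p + a) * (1 - 2 * p * a) \<le> (1 - z) * (1 - y) * (1 - p * q)"
    using merge_factors[OF z(2) y(2)] by (intro low) (simp add: a_def algebra_simps)
  have low3: "p + a * (1 - 2 * p) \<le> (1 - z) * (1 - y) * (1 - p * q)"
  proof -
    have "0 \<le> 2 * p * a * (1 - p - a)" using a p by (intro mult_nonneg_nonneg) auto
    then have "p + a * (1 - 2 * p) \<le> (p + a) * (1 - 2 * p * a)" by (simp add: algebra_simps)
    then show ?thesis using low1 by linarith
  qed
  \<comment> \<open>For \<open>41/100 <= p <= 1/2\<close> the bound \<open>low3\<close> is at least
    \<open>p\<close>, and \<open>41/100\<close> exceeds \<open>256/625\<close>.\<close>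
  consider "p \<le> 1/4" | "1/4 \<le> p" "p \<le> 1/3" | "1/3 \<le> p" "p \<le> 41/100" "a \<le> 3/10"
    | "1/3 \<le> p" "p \<le> 41/100" "3/10 \<le> a" | "41/100 \<le> p" "p \<le> 1/2" | "1/2 \<le> p" by linarith
  then show ?thesis
  proof cases
    case 1
    have "p * q \<le> (1/4) * 1" using 1 p q by (intro mult_mono) auto
    then have "(3/4) * (3/4) * (3/4) \<le> (1 - z) * (1 - y) * (1 - p * q)"
      using 1 y z by (intro mult_mono) auto
    then show ?thesis by simp
  next
    case 2
    \<comment> \<open>The right side is concave in \<open>a\<close> on the interval from
      \<open>1 - 3 * p\<close> to \<open>1 - p\<close>, of length \<open>2 * p\<close>;
      \<open>A1\<close> and \<open>A2\<close> treat its end points.\<close>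
    have "(1 - 3 * p) / 2 \<le> a * (1 - 4 * p^2 - 2 * p * a)"
    proof -
      have "(1 - 3 * p) * (1/2) \<le> (1 - 3 * p) * (1 - 2 * p + 2 * p^2)"
        using 2 zero_le_power2[of "p - 1/2"] by (intro mult_left_mono) (auto simp: field_simps power2_eq_square)
      then have A1: "(1 - 3 * p) / 2 \<le> (1 - 3 * p) * (1 - 2 * p + 2 * p^2)" by simp
      have A2: "(1 - 3 * p) / 2 \<le> (1 - p) * (1 - 2 * p - 2 * p^2)"
      proof -
        have *: "(1 - p) * (1 - 2 * p - 2 * p^2) = (1 - 3 * p) + 2 * p^3"
          by (simp add: algebra_simps power2_eq_square power3_eq_cube)
        have "0 \<le> p^3" using p by simp
        moreover have "(1 - 3 * p) / 2 \<le> 1 - 3 * p" using 2 by (simp add: field_simps)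
        ultimately show ?thesis unfolding * by linarith
      qed
      have "(1 - p - a) * ((1 - 3 * p) / 2) + (a - (1 - 3 * p)) * ((1 - 3 * p) / 2)
          \<le> (1 - p - a) * ((1 - 3 * p) * (1 - 2 * p + 2 * p^2)) + (a - (1 - 3 * p)) * ((1 - p) * (1 - 2 * p - 2 * p^2))"
        using a by (intro add_mono mult_left_mono A1 A2) auto
      also have "\<dots> = 2 * p * (a * (1 - 4 * p^2 - 2 * p * a)) - 2 * p * (2 * p * (a - (1 - 3 * p)) * (1 - p - a))"
        by (simp add: algebra_simps power2_eq_square power3_eq_cube)
      also have "\<dots> \<le> 2 * p * (a * (1 - 4 * p^2 - 2 * p * a))"
        using a p by simp
      also have "(1 - p - a) * ((1 - 3 * p) / 2) + (a - (1 - 3 * p)) * ((1 - 3 * p) / 2) = 2 * p * ((1 - 3 * p) / 2)"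
        by (simp add: field_simps)
      finally show ?thesis using 2 by (simp only: mult_le_cancel_left, linarith?)
    qed
    then have "(1 - p) * (2 * p + (1 - 3 * p) / 2) \<le> (1 - p) * (2 * p + a * (1 - 4 * p^2 - 2 * p * a))"
      using p by (intro mult_left_mono) auto
    also have "\<dots> = (1 - p) * (2 * p + a) * (1 - 2 * p * a)" by (simp add: algebra_simps power2_eq_square)
    also note low2
    finally have "(1 - p^2) / 2 \<le> (1 - z) * (1 - y) * (1 - p * q)"
      by (simp add: field_simps power2_eq_square)
    moreover have "p^2 \<le> (1/3)^2" using 2 by (intro power_mono) auto
    then have "256/625 \<le> (1 - p^2) / 2" by (simp add: power2_eq_square)
    ultimately show ?thesis by linarith
  next
    case 3
    have "p * p \<le> (41/100) * (41/100)" "p * a \<le> (41/100) * (3/10)" using 3 a p by (intro mult_mono; simp)+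
    then have "0 \<le> a * (1 - 4 * (p * p) - 2 * (p * a))" using a by (intro mult_nonneg_nonneg) auto
    then have "(1 - p) * (2 * p) \<le> (1 - p) * (2 * p + a * (1 - 4 * (p * p) - 2 * (p * a)))"
      using p by (intro mult_left_mono) auto
    also have "\<dots> = (1 - p) * (2 * p + a) * (1 - 2 * p * a)" by (simp add: algebra_simps)
    also note low2
    finally have "(1 - p) * (2 * p) \<le> (1 - z) * (1 - y) * (1 - p * q)" .
    moreover have "0 \<le> (p - 1/3) * (2/3 - p)" using 3 by (intro mult_nonneg_nonneg) auto
    then have "256/625 \<le> (1 - p) * (2 * p)" by (simp add: field_simps)
    ultimately show ?thesis by linarith
  next
    case 4
    have "3/10 * (1 - 2 * p) \<le> a * (1 - 2 * p)" using 4 by (intro mult_right_mono) auto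
    moreover have "43/100 \<le> p + 3/10 * (1 - 2 * p)" using 4 by (simp add: field_simps)
    ultimately show ?thesis using low3 by linarith
  next
    case 5
    have "0 \<le> a * (1 - 2 * p)" using 5 a by (intro mult_nonneg_nonneg) auto
    then show ?thesis using low3 5 by linarith
  next
    case 6
    have "(1 - p) * (1 - 2 * p) \<le> a * (1 - 2 * p)" using 6 a by (intro mult_right_mono_neg) auto
    moreover have "1/2 \<le> p + (1 - p) * (1 - 2 * p)"
      using zero_le_power2[of "2 * p - 1"] by (simp add: field_simps power2_eq_square)
    ultimately show ?thesis using low3 by linarith
  qed
qed

subsection \<open>Sums of independent two-valued variables\<close>

text \<open>An entry \<open>(p, u)\<close> stands for a variable that is \<open>u\<close> with probability \<open>p\<close> and 0 otherwise;
  \<open>light_prob xs t\<close> is the probability that the sum of independent such variables is below \<open>t\<close>.\<close>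

primrec light_prob :: "(real \<times> real) list \<Rightarrow> real \<Rightarrow> real" where
  "light_prob [] t = (if 0 < t then 1 else 0)"
| "light_prob (x # xs) t = fst x * light_prob xs (t - snd x) + (1 - fst x) * light_prob xs t"

definition atoms :: "(real \<times> real) list \<Rightarrow> bool" where
  "atoms xs \<longleftrightarrow> (\<forall>x\<in>set xs. 0 \<le> fst x \<and> fst x \<le> 1 \<and> 0 \<le> snd x)"

lemma atoms_simps [simp]:
  "atoms []"
  "atoms (x # xs) \<longleftrightarrow> 0 \<le> fst x \<and> fst x \<le> 1 \<and> 0 \<le> snd x \<and> atoms xs"
  by (auto simp: atoms_def)

lemma light_prob_nonneg: "atoms xs \<Longrightarrow> 0 \<le> light_prob xs t"
  by (induction xs arbitrary: t) auto

lemma light_prob_le_1: "atoms xs \<Longrightarrow> light_prob xs t \<le> 1"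
proof (induction xs arbitrary: t)
  case (Cons x xs)
  then show ?case
    using convex_bound_le[of "light_prob xs (t - snd x)" 1 "light_prob xs t" "fst x" "1 - fst x"] by simp
qed simp

lemma light_prob_eq_1: "atoms xs \<Longrightarrow> sum_list (map snd xs) < t \<Longrightarrow> light_prob xs t = 1"
proof (induction xs arbitrary: t)
  case (Cons x xs)
  then show ?case using Cons.IH[of "t - snd x"] Cons.IH[of t] by simp
qed simp

lemma light_prob_ge_all_low:
  "atoms xs \<Longrightarrow> 0 < t \<Longrightarrow> (\<Prod>x\<leftarrow>xs. 1 - fst x) \<le> light_prob xs t"
proof (induction xs arbitrary: t)
  case (Cons x xs)
  have "(1 - fst x) * (\<Prod>x\<leftarrow>xs. 1 - fst x) \<le> (1 - fst x) * light_prob xs t"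
    using Cons by (intro mult_left_mono) auto
  moreover have "0 \<le> fst x * light_prob xs (t - snd x)"
    using Cons.prems by (intro mult_nonneg_nonneg light_prob_nonneg) auto
  ultimately show ?case by simp
qed simp

text \<open>Markov's inequality, multiplied out so that it holds for every real \<open>t\<close>:
  the induction lowers the threshold by \<open>snd x\<close>, possibly below 0.\<close>

lemma light_prob_markov:
  "atoms xs \<Longrightarrow> t - (\<Sum>x\<leftarrow>xs. fst x * snd x) \<le> t * light_prob xs t"
proof (induction xs arbitrary: t)
  case (Cons x xs)
  have x: "0 \<le> fst x" "fst x \<le> 1" "0 \<le> snd x" and xs: "atoms xs" using Cons.prems by auto
  have "(t - snd x) * light_prob xs (t - snd x) \<le> t * light_prob xs (t - snd x)"
    using x light_prob_nonneg[OF xs] by (intro mult_right_mono) auto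
  then have "fst x * (t - snd x - (\<Sum>x\<leftarrow>xs. fst x * snd x)) \<le> fst x * (t * light_prob xs (t - snd x))"
    using x Cons.IH[OF xs, of "t - snd x"] by (intro mult_left_mono) auto
  moreover have "(1 - fst x) * (t - (\<Sum>x\<leftarrow>xs. fst x * snd x)) \<le> (1 - fst x) * (t * light_prob xs t)"
    using x Cons.IH[OF xs, of t] by (intro mult_left_mono) auto
  ultimately show ?case by (simp add: algebra_simps)
qed simp

lemma light_prob_move_front: "light_prob (ys @ x # zs) t = light_prob (x # ys @ zs) t"
proof (induction ys arbitrary: t)
  case (Cons y ys)
  show ?case by (simp add: Cons.IH algebra_simps)
qed simp

lemma light_prob_mset_cong: "mset xs = mset ys \<Longrightarrow> light_prob xs t = light_prob ys t"
proof (induction xs arbitrary: ys t)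
  case (Cons x xs)
  then have "x \<in> set ys" by (metis list.set_intros(1) set_mset_mset)
  then obtain ys1 ys2 where ys: "ys = ys1 @ x # ys2" by (auto dest: split_list)
  with Cons.prems have "mset xs = mset (ys1 @ ys2)" by simp
  from Cons.IH[OF this] show ?case unfolding ys light_prob_move_front by simp
qed simp

lemma light_prob_scale:
  assumes "0 < s"
  shows "light_prob (map (\<lambda>x. (fst x, s * snd x)) xs) (s * t) = light_prob xs t"
proof (induction xs arbitrary: t)
  case Nil
  show ?case using assms by (simp add: zero_less_mult_iff)
next
  case (Cons x xs)
  show ?case using Cons.IH[of "t - snd x"] Cons.IH[of t] by (simp add: right_diff_distrib)
qed

lemma light_prob_pair_ge:
  assumes "atoms [(p, a), (q, b)]" "a < t" "b < t"
  shows "1 - p * q \<le> light_prob [(p, a), (q, b)] t"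
proof -
  have "0 < t" using assms by auto
  then show ?thesis using assms by (auto simp: algebra_simps)
qed

text \<open>The constraint is increasing in \<open>u\<close> and \<open>w\<close>, and the minimal
  admissible pairs are mixtures of \<open>(1, 0)\<close> and \<open>(1/2, 1/2)\<close>, so it holds
  at one of these two points.\<close>

lemma convex_combination_le:
  fixes A c q u w :: real
  assumes "A + u * c + w * q \<le> 1" "1 \<le> u + w" "w \<le> u" "0 \<le> w" "0 \<le> c" "0 \<le> q"
  shows "A + c \<le> 1 \<or> 2 * A + c + q \<le> 2"
proof (rule ccontr)
  assume "\<not> ?thesis"
  then have gt: "1 < A + c" "2 < 2 * A + c + q" by auto
  show False
  proof (cases "1/2 \<le> w")
    case True
    have "1/2 * c \<le> u * c" "1/2 * q \<le> w * q" using True assms by (intro mult_right_mono; simp)+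
    then show False using assms gt by simp
  next
    case False
    have "(1 - w) * c \<le> u * c" using assms by (intro mult_right_mono) auto
    moreover have "0 < (1 - 2 * w) * (A + c - 1)" using False gt by (intro mult_pos_pos) auto
    moreover have "0 \<le> w * (2 * A + c + q - 2)" using assms gt by (intro mult_nonneg_nonneg) auto
    ultimately show False using assms(1) by (simp add: algebra_simps)
  qed
qed

lemma weighted_average_le:
  fixes a b c u v w :: real
  assumes "0 \<le> u" "0 \<le> v" "0 \<le> w" "1 \<le> u + 2 * v + 3 * w" "u * a + v * b + w * c \<le> 1"
  shows "a \<le> 1 \<or> b \<le> 2 \<or> c \<le> 3"
proof (rule ccontr)
  assume "\<not> ?thesis"
  then have gt: "0 < a - 1" "0 < b - 2" "0 < c - 3" by auto
  have nn: "0 \<le> u * (a - 1)" "0 \<le> v * (b - 2)" "0 \<le> w * (c - 3)"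
    using assms gt by (intro mult_nonneg_nonneg; simp)+
  moreover have "u * (a - 1) + v * (b - 2) + w * (c - 3) \<le> 0" using assms by (simp add: algebra_simps)
  ultimately have "u * (a - 1) = 0" "v * (b - 2) = 0" "w * (c - 3) = 0" by linarith+
  with gt assms(4) show False by auto
qed

lemma triples_heavy_bound:
  fixes x y p q b c d :: real
  assumes y: "0 \<le> y" "y \<le> x" "x \<le> 1" and pq: "0 \<le> p" "p \<le> 1" "0 \<le> q" "q \<le> 1"
    and b: "0 \<le> d" "d \<le> c" "c \<le> b" "1 \<le> b + c + d"
    and le: "b * (2 * x + y) + c * p + d * q \<le> 1"
  shows "x * y * (p + q - p * q) + (x * (1 - y) + (1 - x) * y) * (p * q) \<le> 5/9"
proof -
  have x: "0 \<le> x * y" "0 \<le> x * (1 - y) + (1 - x) * y" using y by auto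
  have pq1: "p * q \<le> p" "0 \<le> (1 - p) * (1 - q)" "p * q \<le> 1"
    using pq by (auto intro: mult_right_le_one_le mult_le_one)
  have "x * y * (p + q - p * q) \<le> x * y * 1"
    using x pq1 by (intro mult_left_mono) (auto simp: algebra_simps)
  moreover have "(x * (1 - y) + (1 - x) * y) * (p * q) \<le> (x * (1 - y) + (1 - x) * y) * p"
    using x pq1 by (intro mult_left_mono) auto
  moreover have "(x * (1 - y) + (1 - x) * y) * p \<le> (x * (1 - y) + (1 - x) * y) * 1"
    using x pq by (intro mult_left_mono) auto
  ultimately have up: "x * y * (p + q - p * q) + (x * (1 - y) + (1 - x) * y) * (p * q)
      \<le> x * y + (x * (1 - y) + (1 - x) * y) * p"
    and up2: "x * y + (x * (1 - y) + (1 - x) * y) * p \<le> x * y + (x * (1 - y) + (1 - x) * y)"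
    by auto
  \<comment> \<open>Summation by parts writes \<open>(b, c, d)\<close> through
    \<open>(1, 0, 0)\<close>, \<open>(1, 1, 0)\<close> and \<open>(1, 1, 1)\<close>. The extreme
    values are thus \<open>(1, 0, 0)\<close>, \<open>(1/2, 1/2, 0)\<close> and
    \<open>(1/3, 1/3, 1/3)\<close>.\<close>
  have "(b - c) * (2 * x + y) + (c - d) * (2 * x + y + p) + d * (2 * x + y + p + q) \<le> 1"
    using le by (simp add: algebra_simps)
  then have "2 * x + y \<le> 1 \<or> 2 * x + y + p \<le> 2 \<or> 2 * x + y + p + q \<le> 3"
    using b by (intro weighted_average_le[of "b - c" "c - d" d]) auto
  then consider "2 * x + y \<le> 1" | "2 * x + y + p \<le> 2" | "2 * x + y + p + q \<le> 3" by blast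
  then show ?thesis
  proof cases
    case 1
    have "4/9 \<le> (1 - x) * (1 - y)" using 1 y by (intro product2_ge) auto
    then show ?thesis using up up2 by (simp add: algebra_simps)
  next
    case 2
    have "p * (x + y) + (1 - p - p * 1) / 1 * (x * y) \<le> 5/9"
      using 2 y pq by (intro balanced_bound) auto
    then show ?thesis using up by (simp add: algebra_simps)
  next
    case 3
    then show ?thesis using three_of_four_bound[OF y(1,2) pq] by simp
  qed
qed

section \<open>The six cases for four two-valued variables\<close>

locale four_atoms =
  fixes p1 p2 p3 p4 u1 u2 u3 u4 :: real
  assumes p1: "0 \<le> p1" "p1 \<le> 1" and p2: "0 \<le> p2" "p2 \<le> 1"
    and p3: "0 \<le> p3" "p3 \<le> 1" and p4: "0 \<le> p4" "p4 \<le> 1"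
    and u: "0 \<le> u4" "u4 \<le> u3" "u3 \<le> u2" "u2 \<le> u1"
    and C1: "2 * u1 * p1 + u2 * p2 + u3 * p3 + u4 * p4 \<le> 1"
    and C2: "u1 * p1 + 2 * u2 * p2 + u3 * p3 + u4 * p4 \<le> 1"
    and C3: "u1 * p1 + u2 * p2 + 2 * u3 * p3 + u4 * p4 \<le> 1"
    and C4: "u1 * p1 + u2 * p2 + u3 * p3 + 2 * u4 * p4 \<le> 1"
begin

definition "light = light_prob [(p1, u1), (p2, u2), (p3, u3), (p4, u4)] 1"
definition "rest = light_prob [(p3, u3), (p4, u4)]"

lemma atoms34: "atoms [(p3, u3), (p4, u4)]" using p3 p4 u by simp

lemma mean_nonneg: "0 \<le> u1 * p1" "0 \<le> u2 * p2" "0 \<le> u3 * p3" "0 \<le> u4 * p4"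
  using p1 p2 p3 p4 u by auto

lemma rest_nonneg: "0 \<le> rest t"
  unfolding rest_def by (rule light_prob_nonneg[OF atoms34])

lemma rest_eq_1: "u3 + u4 < t \<Longrightarrow> rest t = 1"
  unfolding rest_def by (rule light_prob_eq_1[OF atoms34]) simp

lemma rest_ge_pair: "u3 < t \<Longrightarrow> 1 - p3 * p4 \<le> rest t"
  unfolding rest_def using u by (intro light_prob_pair_ge[OF atoms34]) auto

lemma rest_ge_all_low: "0 < t \<Longrightarrow> (1 - p3) * (1 - p4) \<le> rest t"
  unfolding rest_def using light_prob_ge_all_low[OF atoms34] by simp

lemma rest_markov: "t - (u3 * p3 + u4 * p4) \<le> t * rest t"
  unfolding rest_def using light_prob_markov[OF atoms34, of t] by (simp add: algebra_simps)

lemma rest_le_1: "rest t \<le> 1"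
  unfolding rest_def by (rule light_prob_le_1[OF atoms34])

lemma light_ge:
  assumes "a \<le> rest (1 - u1 - u2)" "b \<le> rest (1 - u1)" "c \<le> rest (1 - u2)" "d \<le> rest 1"
  shows "p1 * p2 * a + p1 * (1 - p2) * b + (1 - p1) * p2 * c + (1 - p1) * (1 - p2) * d \<le> light"
proof -
  have "p1 * p2 * a + p1 * (1 - p2) * b + (1 - p1) * p2 * c + (1 - p1) * (1 - p2) * d
    \<le> p1 * p2 * rest (1 - u1 - u2) + p1 * (1 - p2) * rest (1 - u1) + (1 - p1) * p2 * rest (1 - u2)
      + (1 - p1) * (1 - p2) * rest 1"
    using assms p1 p2 by (intro add_mono mult_left_mono) auto
  also have "\<dots> = light" by (simp add: light_def rest_def algebra_simps)
  finally show ?thesis .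
qed

lemma light_singles:
  assumes "1 \<le> u4"
  shows "256/625 \<le> light"
proof -
  have "p1 \<le> u1 * p1" "p2 \<le> u2 * p2" "p3 \<le> u3 * p3" "p4 \<le> u4 * p4"
    using assms u p1 p2 p3 p4 mult_right_mono[of 1 u1 p1] mult_right_mono[of 1 u2 p2]
      mult_right_mono[of 1 u3 p3] mult_right_mono[of 1 u4 p4] by auto
  then have "256/625 \<le> (1 - p1) * (1 - p2) * (1 - p3) * (1 - p4)"
    using p1 p2 p3 p4 C1 C2 C3 C4 by (intro product4_ge) auto
  also have "\<dots> \<le> light"
    unfolding light_def using light_prob_ge_all_low[of "[(p1, u1), (p2, u2), (p3, u3), (p4, u4)]" 1] p1 p2 p3 p4 u
    by (simp add: mult.assoc)
  finally show ?thesis .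
qed

lemma light_only_quadruple:
  assumes "u1 + u2 + u3 < 1"
  shows "1/2 \<le> light"
proof (cases "u1 + u2 + u3 + u4 < 1")
  case True
  have "light = 1" unfolding light_def using p1 p2 p3 p4 u True by (intro light_prob_eq_1) auto
  then show ?thesis by simp
next
  case False
  have "p1 * p2 * p3 * p4 \<le> 1/2"
    using False C1 C2 C3 C4 by (intro all_four_bound[OF p1 p2 p3 p4, of u1 u2 u3 u4]) auto
  moreover have "p1 * p2 * (1 - p3 * p4) + p1 * (1 - p2) * 1 + (1 - p1) * p2 * 1 + (1 - p1) * (1 - p2) * 1 \<le> light"
    using assms u by (intro light_ge rest_ge_pair eq_refl[OF rest_eq_1[symmetric]]) auto
  ultimately show ?thesis by (simp add: algebra_simps)
qed

text \<open>Every heavy set contains the largest value. Either that value is rare enough by itself,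
  or Markov's inequality for the other three variables reduces the claim to
  \<open>star_bound\<close>.\<close>

lemma light_star:
  assumes "u2 + u3 + u4 < 1" "1 \<le> u1 + u2 + u3"
  shows "7/16 \<le> light"
proof -
  let ?xs = "[(p2, u2), (p3, u3), (p4, u4)]"
  define G where "G = light_prob ?xs (1 - u1)"
  have at: "atoms ?xs" using p2 p3 p4 u by simp
  have G: "0 \<le> G" "1 - u1 - (u2 * p2 + u3 * p3 + u4 * p4) \<le> (1 - u1) * G"
    unfolding G_def using light_prob_nonneg[OF at] light_prob_markov[OF at, of "1 - u1"]
    by (simp_all del: light_prob.simps add: algebra_simps)
  have "light = p1 * G + (1 - p1) * light_prob ?xs 1" by (simp add: light_def G_def)
  also have "light_prob ?xs 1 = 1" using assms at by (intro light_prob_eq_1) auto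
  finally have L: "light = 1 - p1 * (1 - G)" by (simp add: algebra_simps)
  show ?thesis
  proof (cases "p1 \<le> 9/16")
    case True
    have "p1 * (1 - G) \<le> p1 * 1" using G p1 by (intro mult_left_mono) auto
    then show ?thesis using True L by simp
  next
    case False
    have u1: "1/3 \<le> u1" using assms u by linarith
    have "u1 * (9/16) \<le> u1 * p1" using False u by (intro mult_left_mono) auto
    then have "u1 < 1" using C1 mean_nonneg by linarith
    have "p1 * ((1 - u1) * (1 - G)) \<le> p1 * (1 - 2 * u1 * p1)"
      using p1 G C1 by (intro mult_left_mono) (auto simp: algebra_simps)
    also have "\<dots> \<le> 9/16 * (1 - u1)" using u1 False by (intro star_bound) auto
    finally have "(1 - u1) * (p1 * (1 - G)) \<le> (1 - u1) * (9/16)" by (simp add: mult_ac)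
    then have "p1 * (1 - G) \<le> 9/16" using \<open>u1 < 1\<close> by (simp only: mult_le_cancel_left_pos diff_gt_0_iff_gt)
    then show ?thesis using L by simp
  qed
qed

text \<open>A heavy sum needs three attained values, and all triples may be counted as heavy.
  Lowering \<open>u1\<close> to \<open>u2\<close> in the constraints lets \<open>p1\<close> and
  \<open>p2\<close> exchange roles.\<close>

lemma light_triples:
  assumes "1 \<le> u2 + u3 + u4" "u1 + u2 < 1"
  shows "4/9 \<le> light"
proof -
  have "p1 * p2 * (p3 + p4 - p3 * p4) + (p1 * (1 - p2) + (1 - p1) * p2) * (p3 * p4) \<le> 5/9"
  proof (cases "p2 \<le> p1")
    case True
    have "u2 * (2 * p1) \<le> u1 * (2 * p1)" using u p1 by (intro mult_right_mono) auto
    then have "u2 * (2 * p1 + p2) + u3 * p3 + u4 * p4 \<le> 1" using C1 by (simp add: algebra_simps)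
    from triples_heavy_bound[OF p2(1) True p1(2) p3 p4 u(1-3) assms(1) this] show ?thesis .
  next
    case False
    have "u2 * p1 \<le> u1 * p1" using u p1 by (intro mult_right_mono) auto
    then have "u2 * (2 * p2 + p1) + u3 * p3 + u4 * p4 \<le> 1" using C2 by (simp add: algebra_simps)
    from triples_heavy_bound[OF p1(1) _ p2(2) p3 p4 u(1-3) assms(1) this] False show ?thesis by (simp add: algebra_simps)
  qed
  moreover have "p1 * p2 * ((1 - p3) * (1 - p4)) + p1 * (1 - p2) * (1 - p3 * p4) + (1 - p1) * p2 * (1 - p3 * p4)
      + (1 - p1) * (1 - p2) * 1 \<le> light"
    using assms u by (intro light_ge rest_ge_pair rest_ge_all_low eq_refl[OF rest_eq_1[symmetric]]) auto
  ultimately show ?thesis by (simp add: algebra_simps)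
qed

lemma light_two_large:
  assumes "1 \<le> u1 + u2" "1 \<le> u2 + u3 + u4" "u3 + u4 < 1"
  shows "5/12 \<le> light" and "u4 = 0 \<Longrightarrow> 27/64 \<le> light"
proof -
  define g h where "g = 1 - rest (1 - u1)" and "h = 1 - rest (1 - u2)"
  have g: "0 \<le> g" "g \<le> 1" and h: "0 \<le> h" "h \<le> 1"
    using rest_nonneg rest_le_1 by (auto simp: g_def h_def)
  have R: "0 \<le> u3 * p3 + u4 * p4" "(1 - u1) * g \<le> u3 * p3 + u4 * p4" "(1 - u2) * h \<le> u3 * p3 + u4 * p4"
    using mean_nonneg rest_markov[of "1 - u1"] rest_markov[of "1 - u2"] by (auto simp: g_def h_def right_diff_distrib)
  have "p1 * p2 * 0 + p1 * (1 - p2) * (1 - g) + (1 - p1) * p2 * (1 - h) + (1 - p1) * (1 - p2) * 1 \<le> light"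
    using assms by (intro light_ge rest_nonneg eq_refl[OF rest_eq_1[symmetric]]) (auto simp: g_def h_def)
  then have L: "1 - (p1 * p2 + p1 * (1 - p2) * g + (1 - p1) * p2 * h) \<le> light"
    by (simp add: algebra_simps)
  have v: "1/3 \<le> u2" using assms u by simp
  have C: "2 * u1 * p1 + u2 * p2 + (u3 * p3 + u4 * p4) \<le> 1" "u1 * p1 + 2 * u2 * p2 + (u3 * p3 + u4 * p4) \<le> 1"
    using C1 C2 by (simp_all add: add.assoc)
  note bnd = two_large_bound[OF p1 p2 g h v u(4) assms(1) R C]
  show "5/12 \<le> light" using bnd(1) L by linarith
  show "27/64 \<le> light" if "u4 = 0"
  proof -
    have "1/2 \<le> u2" using that assms u by simp
    from bnd(2)[OF this] show ?thesis using L by linarith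
  qed
qed

lemma light_pairs:
  assumes "1 \<le> u3 + u4" "u4 < 1"
  shows "256/625 \<le> light" and "u4 = 0 \<Longrightarrow> 27/64 \<le> light"
proof -
  \<comment> \<open>\<open>T\<close> says that the first three probabilities obey the constraints of
    three values equal to 1. Then avoiding these three values already has probability at least
    \<open>27/64\<close>.\<close>
  define T where "T \<longleftrightarrow> 2 * p1 + p2 + p3 \<le> 1 \<and> p1 + 2 * p2 + p3 \<le> 1 \<and> p1 + p2 + 2 * p3 \<le> 1"
  have r1: "1 - p3 \<le> rest 1"
  proof (cases "u3 < 1")
    case True
    have "p3 * p4 \<le> p3 * 1" using p3 p4 by (intro mult_left_mono) auto
    then show ?thesis using rest_ge_pair[OF True] by simp
  next
    case False
    then show ?thesis using assms p3 p4 u by (auto simp: rest_def algebra_simps)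
  qed
  have T: "27/64 \<le> light" if T
  proof -
    have "27/64 \<le> (1 - p1) * (1 - p2) * (1 - p3)"
      using that p1 p2 p3 unfolding T_def by (intro product3_ge) auto
    moreover have "p1 * p2 * 0 + p1 * (1 - p2) * 0 + (1 - p1) * p2 * 0 + (1 - p1) * (1 - p2) * (1 - p3) \<le> light"
      by (intro light_ge rest_nonneg r1)
    ultimately show ?thesis by simp
  qed
  have u34: "1 \<le> u3 + u4" "u4 \<le> u3" "0 \<le> u4" using assms u by auto
  have m1: "u3 * p1 \<le> u1 * p1" and m2: "u3 * p2 \<le> u2 * p2" using u p1 p2 by (auto intro: mult_right_mono)
  have m1': "p1 \<le> u1 * p1" if "1 \<le> u1" using that p1 mult_right_mono[of 1 u1 p1] by simp
  have m2': "p2 \<le> u2 * p2" if "1 \<le> u2" using that p2 mult_right_mono[of 1 u2 p2] by simp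
  have m3': "p3 \<le> u3 * p3" if "1 \<le> u3" using that p3 mult_right_mono[of 1 u3 p3] by simp
  \<comment> \<open>If \<open>T\<close> fails through \<open>A + c > 1\<close>, the extreme point
    \<open>(u3, u4) = (1, 0)\<close> is excluded, and \<open>(1/2, 1/2)\<close> gives an inequality
    that involves \<open>p4\<close>.\<close>
  have split: "A + c \<le> 1 \<or> 2 * A + c + p4 \<le> 2" if "A + u3 * c + u4 * p4 \<le> 1" "0 \<le> c" for A c
    using that u34 p4 convex_combination_le[of A u3 c u4 p4] by auto
  have max3: "(p2 \<le> p1 \<and> p3 \<le> p1) \<or> (p1 \<le> p2 \<and> p3 \<le> p2) \<or> (p1 \<le> p3 \<and> p2 \<le> p3)" by linarith
  have "256/625 \<le> light \<and> (u4 = 0 \<longrightarrow> 27/64 \<le> light)"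
  proof (cases "1 \<le> u3")
    case True
    have T using C1 C2 C3 m1'[OF order_trans[OF order_trans[OF True u(3)] u(4)]] m2'[OF order_trans[OF True u(3)]]
        m3'[OF True] mean_nonneg(4) unfolding T_def by linarith
    from T[OF this] show ?thesis by linarith
  next
    case u3: False
    have "256/625 \<le> light"
    proof (cases T)
      case True
      from T[OF this] show ?thesis by linarith
    next
      case notT: False
      consider "u1 < 1" | "1 \<le> u1" "u2 < 1" | "1 \<le> u1" "1 \<le> u2" by linarith
      then show ?thesis
      proof cases
        case 1
        define e where "e = p1 * (1 - p2) * (1 - p3) + (1 - p1) * p2 * (1 - p3) + (1 - p1) * (1 - p2) * p3"
        have e: "0 \<le> e" unfolding e_def using p1 p2 p3 by auto
        have "p1 * p2 * 0 + p1 * (1 - p2) * ((1 - p3) * (1 - p4)) + (1 - p1) * p2 * ((1 - p3) * (1 - p4))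
            + (1 - p1) * (1 - p2) * (1 - p3 * p4) \<le> light"
          using 1 u3 u by (intro light_ge rest_ge_pair rest_ge_all_low rest_nonneg) auto
        then have L: "(1 - p1) * (1 - p2) * (1 - p3) + (1 - p4) * e \<le> light"
          by (simp add: e_def algebra_simps)
        \<comment> \<open>\<open>k\<close> is the largest of the three probabilities. The bound
          \<open>L\<close> decreases in \<open>p4\<close>, and \<open>split\<close> gives
          \<open>p4 <= 1 - t\<close>.\<close>
        have key: "256/625 \<le> light" if k: "0 \<le> p" "p \<le> k" "0 \<le> r" "r \<le> k" "k \<le> 1"
          and C: "u3 * (2 * k + p + r) + u4 * p4 \<le> 1" and n: "1 < 2 * k + p + r"
          and eq: "(1 - k) * (1 - p) * (1 - r) = (1 - p1) * (1 - p2) * (1 - p3)"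
            "k * (1 - p) * (1 - r) + (1 - k) * p * (1 - r) + (1 - k) * (1 - p) * r = e" for k p r
        proof -
          define t where "t = 2 * k + p + r - 1"
          have t: "0 \<le> t" "t \<le> 1 - p4" using split[of 0 "2 * k + p + r"] C n k by (auto simp: t_def)
          have "27/64 \<le> (1 - k) * (1 - p) * (1 - r) + t * (k * (1 - p) * (1 - r) + (1 - k) * p * (1 - r) + (1 - k) * (1 - p) * r)"
            using k t p4 by (intro at_most_one_of_three_light) (auto simp: t_def)
          also have "\<dots> = (1 - p1) * (1 - p2) * (1 - p3) + t * e" unfolding eq ..
          also have "\<dots> \<le> (1 - p1) * (1 - p2) * (1 - p3) + (1 - p4) * e"
            using t e by (intro add_left_mono mult_right_mono) auto
          finally show ?thesis using L by linarith
        qed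
        from max3 consider "p2 \<le> p1" "p3 \<le> p1" | "p1 \<le> p2" "p3 \<le> p2" | "p1 \<le> p3" "p2 \<le> p3" by blast
        then show ?thesis
        proof cases
          case 1
          show ?thesis
            using 1 notT p1 p2 p3 C1 m1 m2 unfolding T_def
            by (intro key[where k = p1 and p = p2 and r = p3]) (auto simp: e_def algebra_simps)
        next
          case 2
          show ?thesis
            using 2 notT p1 p2 p3 C2 m1 m2 unfolding T_def
            by (intro key[where k = p2 and p = p1 and r = p3]) (auto simp: e_def algebra_simps)
        next
          case 3
          show ?thesis
            using 3 notT p1 p2 p3 C3 m1 m2 unfolding T_def
            by (intro key[where k = p3 and p = p1 and r = p2]) (auto simp: e_def algebra_simps)
        qed
      next
        case 2
        have "p1 * p2 * 0 + p1 * (1 - p2) * 0 + (1 - p1) * p2 * ((1 - p3) * (1 - p4))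
            + (1 - p1) * (1 - p2) * (1 - p3 * p4) \<le> light"
          using 2 u3 by (intro light_ge rest_ge_pair rest_ge_all_low rest_nonneg) auto
        then have L: "(1 - p1) * (1 - (p2 * p3 + (p2 + p3 - 2 * (p2 * p3)) * p4)) \<le> light"
          by (simp add: algebra_simps)
        note m = m1'[OF 2(1)] m2
        from max3 consider "p2 \<le> p1" "p3 \<le> p1" | "p1 \<le> p2" "p3 \<le> p2" | "p1 \<le> p3" "p2 \<le> p3" by blast
        then show ?thesis
        proof cases
          case 1
          have "2 * p1 + u3 * (p2 + p3) + u4 * p4 \<le> 1" using C1 m by (simp add: distrib_left)
          from split[OF this] have "4 * p1 + p2 + p3 + p4 \<le> 2"
            using 1 notT p2 p3 unfolding T_def by auto
          then have "27/64 \<le> (1 - p1) * (1 - (p2 * p3 + (p2 + p3 - 2 * (p2 * p3)) * p4))"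
            using 1 p2 p3 p4 by (intro one_forced_first) auto
          then show ?thesis using L by linarith
        next
          case 2
          have "p1 + u3 * (2 * p2 + p3) + u4 * p4 \<le> 1" using C2 m by (simp add: distrib_left)
          from split[OF this] have "2 * p1 + 2 * p2 + p3 + p4 \<le> 2"
            using 2 notT p2 p3 unfolding T_def by auto
          then have "256/625 \<le> (1 - p1) * (1 - (p2 * p3 + (p2 + p3 - 2 * (p2 * p3)) * p4))"
            using 2 p1 p2 p3 p4 by (intro one_forced_other) auto
          then show ?thesis using L by linarith
        next
          case 3
          have "p1 + u3 * (2 * p3 + p2) + u4 * p4 \<le> 1" using C3 m by (simp add: distrib_left)
          from split[OF this] have "2 * p1 + 2 * p3 + p2 + p4 \<le> 2"
            using 3 notT p2 p3 unfolding T_def by auto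
          then have "256/625 \<le> (1 - p1) * (1 - (p3 * p2 + (p3 + p2 - 2 * (p3 * p2)) * p4))"
            using 3 p1 p2 p3 p4 by (intro one_forced_other) auto
          then show ?thesis using L by (simp add: algebra_simps)
        qed
      next
        case 3
        have "p1 * p2 * 0 + p1 * (1 - p2) * 0 + (1 - p1) * p2 * 0
            + (1 - p1) * (1 - p2) * (1 - p3 * p4) \<le> light"
          using u3 by (intro light_ge rest_ge_pair rest_nonneg) auto
        then have L: "(1 - p1) * (1 - p2) * (1 - p3 * p4) \<le> light" by simp
        note m = m1'[OF 3(1)] m2'[OF 3(2)]
        from max3 consider "p2 \<le> p1" "p3 \<le> p1" | "p1 \<le> p2" "p3 \<le> p2" | "p1 \<le> p3" "p2 \<le> p3" by blast
        then show ?thesis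
        proof cases
          case 1
          have "(2 * p1 + p2) + u3 * p3 + u4 * p4 \<le> 1" using C1 m by simp
          from split[OF this] have "4 * p1 + 2 * p2 + p3 + p4 \<le> 2"
            using 1 notT p3 unfolding T_def by auto
          then have "27/64 \<le> (1 - p1) * (1 - p2) * (1 - p3 * p4)"
            using 1 p2 p3 p4 by (intro two_forced_first) auto
          then show ?thesis using L by linarith
        next
          case 2
          have "(p1 + 2 * p2) + u3 * p3 + u4 * p4 \<le> 1" using C2 m by simp
          from split[OF this] have "4 * p2 + 2 * p1 + p3 + p4 \<le> 2"
            using 2 notT p3 unfolding T_def by auto
          then have "27/64 \<le> (1 - p2) * (1 - p1) * (1 - p3 * p4)"
            using 2 p1 p3 p4 by (intro two_forced_first) auto
          then show ?thesis using L by (simp only: mult.commute[of "1 - p2" "1 - p1"])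
        next
          case 3
          have "(p1 + p2) + u3 * (2 * p3) + u4 * p4 \<le> 1" using C3 m by simp
          from split[OF this] have "2 * p1 + 2 * p2 + 2 * p3 + p4 \<le> 2"
            using 3 notT p3 unfolding T_def by auto
          then have "256/625 \<le> (1 - p1) * (1 - p2) * (1 - p3 * p4)"
            using 3 p1 p2 p4 by (intro two_forced_other) auto
          then show ?thesis using L by linarith
        qed
      qed
    qed
    \<comment> \<open>Here \<open>u3 < 1\<close> and \<open>u3 + u4 >= 1\<close> exclude
      \<open>u4 = 0\<close>, so \<open>27/64\<close> is not asked for.\<close>
    then show ?thesis using u3 assms by auto
  qed
  then show "256/625 \<le> light" and "u4 = 0 \<Longrightarrow> 27/64 \<le> light" by auto
qed

lemma light_ge_bounds:
  shows "256/625 \<le> light" and "u4 = 0 \<Longrightarrow> 27/64 \<le> light"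
proof -
  consider "1 \<le> u4" | "u1 + u2 + u3 < 1" | "u2 + u3 + u4 < 1" "1 \<le> u1 + u2 + u3"
    | "1 \<le> u2 + u3 + u4" "u1 + u2 < 1" | "1 \<le> u1 + u2" "1 \<le> u2 + u3 + u4" "u3 + u4 < 1"
    | "1 \<le> u3 + u4" "u4 < 1" by linarith
  then have "256/625 \<le> light \<and> (u4 = 0 \<longrightarrow> 27/64 \<le> light)"
  proof cases
    case 1 then show ?thesis using light_singles by auto
  next
    case 2 then show ?thesis using light_only_quadruple by auto
  next
    case 3 then show ?thesis using light_star by auto
  next
    case 4 then show ?thesis using light_triples by auto
  next
    case 5 then show ?thesis using light_two_large by fastforce
  next
    case 6 then show ?thesis using light_pairs by blast
  qed
  then show "256/625 \<le> light" and "u4 = 0 \<Longrightarrow> 27/64 \<le> light" by auto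
qed

end

subsection \<open>Two-point laws and their mixtures\<close>

lemma light_prob_four:
  assumes at: "atoms xs" and len: "length xs = 4"
    and le: "\<And>y. y \<in> set xs \<Longrightarrow> (\<Sum>x\<leftarrow>xs. fst x * snd x) + fst y * snd y \<le> 1"
  shows "256/625 \<le> light_prob xs 1"
    and "\<exists>y\<in>set xs. snd y = 0 \<Longrightarrow> 27/64 \<le> light_prob xs 1"
proof -
  define ys where "ys = rev (sort_key snd xs)"
  have mset: "mset ys = mset xs" by (simp add: ys_def)
  have set: "set ys = set xs" by (simp add: ys_def)
  have sorted: "sorted_wrt (\<lambda>a b. snd b \<le> snd a) ys"
    unfolding ys_def sorted_wrt_rev using sorted_sort_key[of snd xs] by (simp add: sorted_map)
  have sum: "(\<Sum>x\<leftarrow>ys. fst x * snd x) = (\<Sum>x\<leftarrow>xs. fst x * snd x)"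
    unfolding sum_mset_sum_list[symmetric] mset_map mset ..
  have "length ys = Suc (Suc (Suc (Suc 0)))" using len by (simp add: ys_def)
  then obtain a b c d where ys: "ys = [a, b, c, d]" by (auto simp: length_Suc_conv)
  have at': "atoms ys" using at by (simp add: atoms_def set)
  have le': "(\<Sum>x\<leftarrow>ys. fst x * snd x) + fst y * snd y \<le> 1" if "y \<in> set ys" for y
    using le that unfolding set sum .
  interpret four_atoms "fst a" "fst b" "fst c" "fst d" "snd a" "snd b" "snd c" "snd d"
    using at' sorted le'[of a] le'[of b] le'[of c] le'[of d] by unfold_locales (auto simp: ys mult.commute)
  have light: "light_prob xs 1 = light"
    unfolding light_def by (subst light_prob_mset_cong[OF mset[symmetric]]) (simp add: ys)
  show "256/625 \<le> light_prob xs 1" unfolding light by (rule light_ge_bounds(1))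
  show "27/64 \<le> light_prob xs 1" if "\<exists>y\<in>set xs. snd y = 0"
  proof -
    have "snd d = 0" using that u unfolding set[symmetric] ys by auto
    then show ?thesis unfolding light by (rule light_ge_bounds(2))
  qed
qed

lemma light_prob_four_scaled:
  assumes at: "atoms xs" and len: "length xs = 4" and s: "0 < s"
    and le: "\<And>y. y \<in> set xs \<Longrightarrow> (\<Sum>x\<leftarrow>xs. fst x * snd x) + fst y * snd y \<le> s"
  shows "256/625 \<le> light_prob xs s"
    and "\<exists>y\<in>set xs. snd y = 0 \<Longrightarrow> 27/64 \<le> light_prob xs s"
proof -
  define ys where "ys = map (\<lambda>x. (fst x, 1 / s * snd x)) xs"
  have eq: "light_prob xs s = light_prob ys 1"
    using light_prob_scale[of "1 / s" xs s] s by (simp add: ys_def)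
  have sum: "(\<Sum>x\<leftarrow>ys. fst x * snd x) = 1 / s * (\<Sum>x\<leftarrow>xs. fst x * snd x)"
    by (simp add: ys_def sum_list_const_mult[symmetric] comp_def)
  have at': "atoms ys" and len': "length ys = 4" using at len s by (auto simp: atoms_def ys_def)
  have le': "(\<Sum>x\<leftarrow>ys. fst x * snd x) + fst y * snd y \<le> 1" if y: "y \<in> set ys" for y
  proof -
    obtain x where x: "x \<in> set xs" "y = (fst x, 1 / s * snd x)" using y by (auto simp: ys_def)
    show ?thesis unfolding sum using le[OF x(1)] s by (simp add: x(2) field_simps)
  qed
  show "256/625 \<le> light_prob xs s" unfolding eq by (rule light_prob_four[OF at' len' le'])
  show "27/64 \<le> light_prob xs s" if "\<exists>y\<in>set xs. snd y = 0"
    unfolding eq using that by (intro light_prob_four[OF at' len' le']) (auto simp: ys_def)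
qed

text \<open>Here \<open>(p, a, b)\<close> stands for a variable that is \<open>b\<close> with probability \<open>p\<close> and \<open>a\<close> otherwise.\<close>

primrec two_point_prob :: "(real \<times> real \<times> real) list \<Rightarrow> real \<Rightarrow> real" where
  "two_point_prob [] t = (if 0 < t then 1 else 0)"
| "two_point_prob (x # xs) t =
    (case x of (p, a, b) \<Rightarrow> (1 - p) * two_point_prob xs (t - a) + p * two_point_prob xs (t - b))"

definition two_point_law :: "real \<Rightarrow> real \<times> real \<times> real \<Rightarrow> bool" where
  "two_point_law m = (\<lambda>(p, a, b). 0 \<le> p \<and> p \<le> 1 \<and> 0 \<le> a \<and> a \<le> b \<and> (1 - p) * a + p * b = m)"

lemma two_point_prob_eq_light_prob:
  "two_point_prob xs t = light_prob (map (\<lambda>(p, a, b). (p, b - a)) xs) (t - (\<Sum>(p, a, b)\<leftarrow>xs. a))"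
  by (induction xs arbitrary: t) (auto simp: algebra_simps)

lemma two_point_prob_ge:
  assumes laws: "list_all (two_point_law (1 / (real l + 1))) xs" and len: "length xs = l" and l: "l \<in> {3, 4}"
  shows "(real l / (real l + 1)) ^ l \<le> two_point_prob xs 1"
proof -
  define m where "m = 1 / (real l + 1)"
  define f :: "real \<times> real \<times> real \<Rightarrow> real \<times> real" where "f = (\<lambda>(p, a, b). (p, b - a))"
  define A where "A = (\<Sum>(p, a, b)\<leftarrow>xs. a)"
  have law: "0 \<le> p" "p \<le> 1" "0 \<le> a" "a \<le> b" "p * (b - a) = m - a" "a \<le> m" if "(p, a, b) \<in> set xs" for p a b
  proof -
    have *: "0 \<le> p" "p \<le> 1" "0 \<le> a" "a \<le> b" "(1 - p) * a + p * b = m"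
      using laws that by (auto simp: list_all_iff two_point_law_def m_def)
    then show "0 \<le> p" "p \<le> 1" "0 \<le> a" "a \<le> b" "p * (b - a) = m - a" by (auto simp: algebra_simps)
    moreover have "0 \<le> p * (b - a)" using * by simp
    ultimately show "a \<le> m" by simp
  qed
  have m: "0 < m" "m * (real l + 1) = 1" by (auto simp: m_def)
  have A: "A \<le> real l * m"
  proof -
    have "A \<le> (\<Sum>x\<leftarrow>xs. m)" unfolding A_def by (intro sum_list_mono) (auto dest: law(6))
    then show ?thesis by (simp add: len sum_list_triv)
  qed
  have s: "0 < 1 - A" using A m by (simp add: algebra_simps)
  have sum: "(\<Sum>x\<leftarrow>map f xs. fst x * snd x) = real l * m - A"
  proof -
    have "(\<Sum>x\<leftarrow>map f xs. fst x * snd x) = (\<Sum>(p, a, b)\<leftarrow>xs. m - a)"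
      unfolding map_map by (intro arg_cong[where f = sum_list] map_cong) (auto simp: f_def law(5))
    also have "\<dots> = (\<Sum>x\<leftarrow>xs. m - (case x of (p, a, b) \<Rightarrow> a))"
      by (intro arg_cong[where f = sum_list] map_cong) auto
    also have "\<dots> = real l * m - A" by (simp add: sum_list_subtractf A_def len sum_list_triv)
    finally show ?thesis .
  qed
  have at: "atoms (map f xs)" unfolding atoms_def f_def by (auto dest: law(1,2,4))
  \<comment> \<open>This is where the mean \<open>1 / (l + 1)\<close> matters: the shifted means are
    \<open>m - a\<close>, so their sum plus one of them is
    \<open>(l + 1) * m - A - a = 1 - A - a\<close>, at most the new threshold.\<close>
  have le: "(\<Sum>x\<leftarrow>map f xs. fst x * snd x) + fst y * snd y \<le> 1 - A" if y: "y \<in> set (map f xs)" for y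
  proof -
    obtain p a b where "(p, a, b) \<in> set xs" "y = (p, b - a)" using y by (auto simp: f_def)
    then show ?thesis unfolding sum using law(3,5)[of p a b] m by (simp add: algebra_simps)
  qed
  have eq: "two_point_prob xs 1 = light_prob (map f xs) (1 - A)"
    by (simp add: two_point_prob_eq_light_prob f_def A_def)
  consider "l = 4" | "l = 3" using l by auto
  then show ?thesis
  proof cases
    case 1
    then show ?thesis unfolding eq using light_prob_four_scaled(1)[OF at _ s le] len by (simp add: power_divide)
  next
    case 2
    have "27/64 \<le> light_prob ((0, 0) # map f xs) (1 - A)"
    proof (rule light_prob_four_scaled(2))
      show "(\<Sum>x\<leftarrow>(0, 0) # map f xs. fst x * snd x) + fst y * snd y \<le> 1 - A" if "y \<in> set ((0, 0) # map f xs)" for y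
      proof (cases "y \<in> set (map f xs)")
        case True
        from le[OF this] show ?thesis by simp
      next
        case False
        then have "y = (0, 0)" using that by auto
        then show ?thesis using sum m by (simp add: algebra_simps)
      qed
    qed (use at s 2 len in auto)
    then show ?thesis unfolding eq using 2 by (simp add: power_divide)
  qed
qed

text \<open>Every finite law with mean \<open>m\<close> is a mixture of laws with mean \<open>m\<close> on two of its points, one on
  each side of \<open>m\<close>; the pair \<open>i, j\<close> receives weight proportional to \<open>\<pi> i * \<pi> j * (w j - w i)\<close>.\<close>

lemma sum_ge_of_two_point:
  fixes w \<pi> :: "'a \<Rightarrow> real" and f :: "real \<Rightarrow> real"
  assumes I: "finite I" and \<pi>: "\<And>i. i \<in> I \<Longrightarrow> 0 \<le> \<pi> i" "(\<Sum>i\<in>I. \<pi> i) = 1"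
    and w: "\<And>i. i \<in> I \<Longrightarrow> 0 \<le> w i" and mean: "(\<Sum>i\<in>I. \<pi> i * w i) = m"
    and f: "\<And>p a b. two_point_law m (p, a, b) \<Longrightarrow> c \<le> (1 - p) * f a + p * f b"
  shows "c \<le> (\<Sum>i\<in>I. \<pi> i * f (w i))"
proof -
  define L where "L = {i \<in> I. w i \<le> m}"
  define U where "U = {i \<in> I. m < w i}"
  have fin: "finite L" "finite U" and LU: "I = L \<union> U" "L \<inter> U = {}" using I by (auto simp: L_def U_def)
  have sumI: "(\<Sum>i\<in>I. g i) = (\<Sum>i\<in>L. g i) + (\<Sum>i\<in>U. g i)" for g :: "'a \<Rightarrow> real"
    unfolding LU(1) using fin LU(2) by (rule sum.union_disjoint)
  define S where "S = (\<Sum>i\<in>L. \<pi> i * (m - w i))"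
  have SU: "S = (\<Sum>j\<in>U. \<pi> j * (w j - m))"
  proof -
    have "(\<Sum>i\<in>I. \<pi> i * (m - w i)) = 0"
      using \<pi>(2) mean by (simp add: right_diff_distrib sum_subtractf flip: sum_distrib_right)
    then show ?thesis unfolding sumI S_def by (simp add: sum_negf[symmetric] algebra_simps sum_subtractf)
  qed
  have fm: "c \<le> f m" if "0 \<le> m" using f[of 0 m m] that by (simp add: two_point_law_def)
  have S0: "0 \<le> S" unfolding S_def using \<pi> by (intro sum_nonneg mult_nonneg_nonneg) (auto simp: L_def)
  have m0: "0 \<le> m" unfolding mean[symmetric] using \<pi> w by (intro sum_nonneg mult_nonneg_nonneg) auto
  show ?thesis
  \<comment> \<open>\<open>S\<close> is the total deviation from \<open>m\<close> on either side. If
    it vanishes, all mass sits at \<open>m\<close>, the degenerate two-point law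
    \<open>(0, m, m)\<close>.\<close>
  proof (cases "S = 0")
    case True
    have zero: "\<pi> i * (m - w i) = 0" if "i \<in> L" for i
      using True that fin \<pi> unfolding S_def
      by (subst (asm) sum_nonneg_eq_0_iff) (auto simp: L_def)
    have zero': "\<pi> i * (w i - m) = 0" if "i \<in> U" for i
      using True that fin \<pi> unfolding SU
      by (subst (asm) sum_nonneg_eq_0_iff) (auto simp: U_def)
    have "\<pi> i * f (w i) = \<pi> i * f m" if "i \<in> I" for i
      using zero[of i] zero'[of i] that unfolding LU(1) by auto
    then have "(\<Sum>i\<in>I. \<pi> i * f (w i)) = (\<Sum>i\<in>I. \<pi> i * f m)" by (rule sum.cong[OF refl])
    also have "\<dots> = f m" using \<pi>(2) by (simp flip: sum_distrib_right)
    finally show ?thesis using fm[OF m0] by simp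
  next
    case False
    with S0 have S: "0 < S" by simp
    have pair: "0 \<le> (w j - m) * (f (w i) - c) + (m - w i) * (f (w j) - c)" if "i \<in> L" "j \<in> U" for i j
    proof -
      have ij: "w i \<le> m" "m < w j" "0 \<le> w i" using that w by (auto simp: L_def U_def)
      define p where "p = (m - w i) / (w j - w i)"
      have p: "p * (w j - w i) = m - w i" "(1 - p) * (w j - w i) = w j - m"
        using ij by (auto simp: p_def field_simps)
      have pb: "0 \<le> p" "p \<le> 1" using ij by (simp_all add: p_def)
      have "(1 - p) * w i + p * w j = w i + p * (w j - w i)" by (simp add: algebra_simps)
      also have "\<dots> = m" unfolding p(1) by simp
      finally have "(1 - p) * w i + p * w j = m" .
      moreover have "w i \<le> w j" using ij by simp
      ultimately have "two_point_law m (p, w i, w j)"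
        unfolding two_point_law_def prod.case using pb ij(3) by (intro conjI)
      from f[OF this] have "0 \<le> (w j - w i) * ((1 - p) * f (w i) + p * f (w j) - c)"
        using ij by (intro mult_nonneg_nonneg) auto
      also have "\<dots> = ((1 - p) * (w j - w i)) * f (w i) + (p * (w j - w i)) * f (w j) - c * (w j - w i)"
        by (simp add: algebra_simps)
      finally show ?thesis unfolding p by (simp add: algebra_simps)
    qed
    have "0 \<le> (\<Sum>i\<in>L. \<Sum>j\<in>U. \<pi> i * \<pi> j * ((w j - m) * (f (w i) - c) + (m - w i) * (f (w j) - c)))"
      using pair \<pi> by (intro sum_nonneg mult_nonneg_nonneg) (auto simp: L_def U_def)
    also have "\<dots> = (\<Sum>i\<in>L. \<Sum>j\<in>U. (\<pi> i * (f (w i) - c)) * (\<pi> j * (w j - m)))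
        + (\<Sum>i\<in>L. \<Sum>j\<in>U. (\<pi> i * (m - w i)) * (\<pi> j * (f (w j) - c)))"
      unfolding sum.distrib[symmetric] by (intro sum.cong refl) (simp add: algebra_simps)
    also have "\<dots> = (\<Sum>i\<in>L. \<pi> i * (f (w i) - c)) * S + S * (\<Sum>j\<in>U. \<pi> j * (f (w j) - c))"
      unfolding sum_product[symmetric] SU[symmetric] S_def[symmetric] ..
    also have "\<dots> = S * (\<Sum>i\<in>I. \<pi> i * (f (w i) - c))" unfolding sumI by (simp add: algebra_simps)
    finally have "0 \<le> (\<Sum>i\<in>I. \<pi> i * (f (w i) - c))" using S by (simp add: zero_le_mult_iff)
    then show ?thesis using \<pi>(2) by (simp add: right_diff_distrib sum_subtractf flip: sum_distrib_right)
  qed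
qed

text \<open>The probability that a sum of independent variables is below \<open>t\<close>, where \<open>n\<close> of them take the
  value \<open>w i\<close> with probability \<open>\<pi> i\<close> and the others have the two-point laws \<open>xs\<close>.\<close>

primrec mixture_prob ::
  "'a set \<Rightarrow> ('a \<Rightarrow> real) \<Rightarrow> ('a \<Rightarrow> real) \<Rightarrow> nat \<Rightarrow> (real \<times> real \<times> real) list \<Rightarrow> real \<Rightarrow> real" where
  "mixture_prob I \<pi> w 0 xs t = two_point_prob xs t"
| "mixture_prob I \<pi> w (Suc n) xs t = (\<Sum>i\<in>I. \<pi> i * mixture_prob I \<pi> w n xs (t - w i))"

lemma mixture_prob_Cons:
  "mixture_prob I \<pi> w n ((p, a, b) # xs) t
    = (1 - p) * mixture_prob I \<pi> w n xs (t - a) + p * mixture_prob I \<pi> w n xs (t - b)"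
proof (induction n arbitrary: t)
  case (Suc n)
  show ?case
    by (simp add: Suc.IH sum_distrib_left sum.distrib[symmetric] algebra_simps)
qed simp

text \<open>One copy of the law at a time is traded for a two-point law, the probability being
  affine in the law of that copy. Generalising over \<open>xs\<close> lets the traded laws
  accumulate until no copy is left.\<close>

lemma mixture_prob_ge:
  assumes I: "finite I" and \<pi>: "\<And>i. i \<in> I \<Longrightarrow> 0 \<le> \<pi> i" "(\<Sum>i\<in>I. \<pi> i) = 1"
    and w: "\<And>i. i \<in> I \<Longrightarrow> 0 \<le> w i" and mean: "(\<Sum>i\<in>I. \<pi> i * w i) = m"
    and two_point: "\<And>ys. list_all (two_point_law m) ys \<Longrightarrow> length ys = N \<Longrightarrow> c \<le> two_point_prob ys t"
  shows "list_all (two_point_law m) xs \<Longrightarrow> length xs + n = N \<Longrightarrow> c \<le> mixture_prob I \<pi> w n xs t"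
proof (induction n arbitrary: xs)
  case 0
  then show ?case using two_point by simp
next
  case (Suc n)
  show ?case
    unfolding mixture_prob.simps
  proof (rule sum_ge_of_two_point[where f = "\<lambda>y. mixture_prob I \<pi> w n xs (t - y)", OF I \<pi> w mean])
    fix p a b assume "two_point_law m (p, a, b)"
    then show "c \<le> (1 - p) * mixture_prob I \<pi> w n xs (t - a) + p * mixture_prob I \<pi> w n xs (t - b)"
      using Suc.prems by (subst mixture_prob_Cons[symmetric], intro Suc.IH) auto
  qed
qed

section \<open>Counting heavy tuples of vertices\<close>

definition heavy_lists :: "'a set \<Rightarrow> ('a \<Rightarrow> real) \<Rightarrow> nat \<Rightarrow> real \<Rightarrow> 'a list set" where
  "heavy_lists V y n t = {xs. set xs \<subseteq> V \<and> length xs = n \<and> t \<le> (\<Sum>v\<leftarrow>xs. y v)}"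

lemma finite_heavy_lists: "finite V \<Longrightarrow> finite (heavy_lists V y n t)"
  unfolding heavy_lists_def by (rule finite_subset[OF _ finite_lists_length_eq[of V n]]) auto

lemma card_heavy_lists_0: "card (heavy_lists V y 0 t) = (if 0 < t then 0 else 1)"
proof -
  have "heavy_lists V y 0 t = (if 0 < t then {} else {[]})" by (auto simp: heavy_lists_def)
  then show ?thesis by simp
qed

lemma card_heavy_lists_Suc:
  assumes "finite V"
  shows "card (heavy_lists V y (Suc n) t) = (\<Sum>v\<in>V. card (heavy_lists V y n (t - y v)))"
proof -
  have "heavy_lists V y (Suc n) t = (\<Union>v\<in>V. (#) v ` heavy_lists V y n (t - y v))"
    by (auto simp: heavy_lists_def length_Suc_conv image_iff algebra_simps)
  also have "card \<dots> = (\<Sum>v\<in>V. card ((#) v ` heavy_lists V y n (t - y v)))"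
    using assms by (intro card_UN_disjoint) (auto simp: finite_heavy_lists)
  finally show ?thesis by (simp add: card_image)
qed

lemma mixture_prob_nonpos:
  assumes "finite I" "\<And>i. i \<in> I \<Longrightarrow> 0 \<le> w i" "t \<le> 0"
  shows "mixture_prob I \<pi> w n [] t = 0"
  using assms(3)
proof (induction n arbitrary: t)
  case (Suc n)
  have "mixture_prob I \<pi> w n [] (t - w i) = 0" if "i \<in> I" for i
    using Suc.IH[of "t - w i"] Suc.prems assms(2)[OF that] by simp
  then show ?case by simp
qed simp

text \<open>The law is padded with an atom at 0 (for the \<open>d\<close> additional vertices) and an atom at 1, which
  makes every tuple heavy and raises the mean to exactly \<open>1 / (l + 1)\<close>.\<close>

lemma mixture_prob_padded_le:
  fixes V :: "'a set" and y :: "'a \<Rightarrow> real" and \<alpha> \<beta> \<theta> c :: real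
  defines "I \<equiv> V <+> (UNIV :: bool set)"
  defines "\<pi> \<equiv> case_sum (\<lambda>v. \<alpha>) (\<lambda>b. if b then \<theta> else \<beta>)"
    and "w \<equiv> case_sum y (\<lambda>b. if b then 1 else 0)"
  assumes V: "finite V" "\<And>v. v \<in> V \<Longrightarrow> 0 \<le> y v"
    and nn: "0 \<le> \<alpha>" "0 \<le> \<beta>" and c: "real (card V) * \<alpha> + \<beta> = c"
  shows "t \<le> 1 \<Longrightarrow> mixture_prob I \<pi> w n [] t \<le> c ^ n - \<alpha> ^ n * real (card (heavy_lists V y n t))"
proof (induction n arbitrary: t)
  case 0
  then show ?case by (simp add: card_heavy_lists_0)
next
  case (Suc n)
  let ?M = "mixture_prob I \<pi> w n []" and ?H = "\<lambda>t. real (card (heavy_lists V y n t))"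
  have I: "finite I" "\<And>i. i \<in> I \<Longrightarrow> 0 \<le> w i" using V by (auto simp: I_def w_def)
  have "mixture_prob I \<pi> w (Suc n) [] t = (\<Sum>v\<in>V. \<alpha> * ?M (t - y v)) + (\<theta> * ?M (t - 1) + \<beta> * ?M t)"
    using V unfolding I_def by (simp add: sum.Plus \<pi>_def w_def UNIV_bool add.commute)
  also have "?M (t - 1) = 0" using I Suc.prems by (intro mixture_prob_nonpos) auto
  also have "(\<Sum>v\<in>V. \<alpha> * ?M (t - y v)) \<le> (\<Sum>v\<in>V. \<alpha> * (c ^ n - \<alpha> ^ n * ?H (t - y v)))"
    using Suc nn V(2) by (intro sum_mono mult_left_mono) (auto simp: add_increasing2 algebra_simps)
  \<comment> \<open>Tuples that use an added vertex are all counted as light; only heavy tuples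
    inside \<open>V\<close> are subtracted.\<close>
  also have "\<beta> * ?M t \<le> \<beta> * c ^ n"
  proof (rule mult_left_mono[OF _ nn(2)])
    have "0 \<le> \<alpha> ^ n * ?H t" using nn by simp
    then show "?M t \<le> c ^ n" using Suc.IH[OF Suc.prems] by linarith
  qed
  also have "(\<Sum>v\<in>V. \<alpha> * (c ^ n - \<alpha> ^ n * ?H (t - y v))) + (\<theta> * 0 + \<beta> * c ^ n)
      = (real (card V) * \<alpha> + \<beta>) * c ^ n - \<alpha> ^ Suc n * real (\<Sum>v\<in>V. card (heavy_lists V y n (t - y v)))"
    by (simp add: right_diff_distrib sum_subtractf sum_distrib_left algebra_simps)
  also have "\<dots> = c ^ Suc n - \<alpha> ^ Suc n * real (card (heavy_lists V y (Suc n) t))"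
    by (simp add: c card_heavy_lists_Suc[OF V(1)])
  finally show ?case by simp
qed

lemma card_heavy_lists_le:
  fixes y :: "'a \<Rightarrow> real"
  assumes V: "finite V" "\<And>v. v \<in> V \<Longrightarrow> 0 \<le> y v"
    and l: "l \<in> {3, 4}" and d: "1 \<le> d"
    and total: "(\<Sum>v\<in>V. y v) \<le> (real (card V) + real d) / (real l + real d)"
  shows "real (card (heavy_lists V y l 1))
      \<le> (1 - (1 - 1 / (real l + real d)) ^ l) * (real (card V) + real d) ^ l"
proof -
  define N where "N = real (card V) + real d"
  define x where "x = (\<Sum>v\<in>V. y v) / N"
  have N: "0 < N" using d by (simp add: N_def add_nonneg_pos)
  have "x \<le> (N / (real l + real d)) / N"
    unfolding x_def using total N by (intro divide_right_mono) (auto simp: N_def)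
  then have x1: "x \<le> 1 / (real l + real d)" using N by simp
  also have "\<dots> \<le> 1 / (real l + 1)" using d by (intro divide_left_mono) auto
  finally have x2: "x \<le> 1 / (real l + 1)" .
  define r where "r = real l / (real l + 1)"
  have r: "0 < r" "r < 1" "r \<le> 1 - x" using l x2 by (auto simp: r_def)
  \<comment> \<open>The solution of \<open>c * x + (1 - c) = 1 / (l + 1)\<close>.\<close>
  define c where "c = r / (1 - x)"
  have c: "0 < c" "c \<le> 1" "c * (1 - x) = r" using r by (auto simp: c_def)
  define \<alpha> where "\<alpha> = c / N"
  define \<beta> where "\<beta> = real d * \<alpha>"
  have \<alpha>: "0 \<le> \<alpha>" "0 \<le> \<beta>" "\<alpha> * (\<Sum>v\<in>V. y v) = c * x"
    using c N by (auto simp: \<alpha>_def \<beta>_def x_def)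
  have "real (card V) * \<alpha> + \<beta> = N * \<alpha>" by (simp add: \<beta>_def N_def distrib_right)
  also have "\<dots> = c" using N by (simp add: \<alpha>_def)
  finally have mass: "real (card V) * \<alpha> + \<beta> = c" .
  let ?I = "V <+> (UNIV :: bool set)"
  let ?\<pi> = "case_sum (\<lambda>v::'a. \<alpha>) (\<lambda>b. if b then 1 - c else \<beta>)"
  let ?w = "case_sum y (\<lambda>b. if b then 1 else 0)"
  have "r ^ l \<le> mixture_prob ?I ?\<pi> ?w l [] 1"
  proof (rule mixture_prob_ge[where m = "1 / (real l + 1)" and N = l])
    show "(\<Sum>i\<in>?I. ?\<pi> i) = 1" using V mass by (simp add: sum.Plus UNIV_bool)
    have "(\<Sum>i\<in>?I. ?\<pi> i * ?w i) = \<alpha> * (\<Sum>v\<in>V. y v) + (1 - c)"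
      using V by (simp add: sum.Plus UNIV_bool sum_distrib_left)
    also have "\<dots> = 1 - r" using \<alpha>(3) c(3) by (simp add: algebra_simps)
    finally show "(\<Sum>i\<in>?I. ?\<pi> i * ?w i) = 1 / (real l + 1)" by (simp add: r_def field_simps)
    show "r ^ l \<le> two_point_prob ys 1" if "list_all (two_point_law (1 / (real l + 1))) ys" "length ys = l" for ys
      unfolding r_def using that l by (rule two_point_prob_ge)
  qed (use V \<alpha> c in auto)
  also have "\<dots> \<le> c ^ l - \<alpha> ^ l * real (card (heavy_lists V y l 1))"
    by (rule mixture_prob_padded_le) (use V \<alpha> mass in auto)
  finally have "\<alpha> ^ l * real (card (heavy_lists V y l 1)) \<le> c ^ l - r ^ l" by simp
  then have "c ^ l * (real (card (heavy_lists V y l 1)) / N ^ l) \<le> c ^ l * (1 - (1 - x) ^ l)"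
    unfolding \<alpha>_def c(3)[symmetric] power_divide power_mult_distrib
    by (simp only: right_diff_distrib times_divide_eq_left times_divide_eq_right mult_1_right)
  then have "real (card (heavy_lists V y l 1)) / N ^ l \<le> 1 - (1 - x) ^ l"
    using c(1) by (simp only: mult_le_cancel_left_pos zero_less_power)
  also have "\<dots> \<le> 1 - (1 - 1 / (real l + real d)) ^ l"
    using x1 d by (intro diff_left_mono power_mono) (auto simp: divide_le_eq)
  finally show ?thesis using N by (simp add: N_def divide_le_eq)
qed

lemma card_le_of_fractional_cover:
  assumes H: "uniform_hypergraph l V E" and l: "l \<in> {3, 4}" and d: "1 \<le> d"
    and y: "\<And>v. v \<in> V \<Longrightarrow> 0 \<le> y v" "\<And>e. e \<in> E \<Longrightarrow> 1 \<le> (\<Sum>v\<in>e. y v)"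
    and total: "(\<Sum>v\<in>V. y v) \<le> (real (card V) + real d) / (real l + real d)"
  shows "real (card E)
      \<le> (1 - (1 - 1 / (real l + real d)) ^ l) * (real (card V) + real d) ^ l / fact l"
proof -
  have V: "finite V" and E: "E \<subseteq> nsets V l" using H by (auto simp: uniform_hypergraph_def)
  have e: "finite e" "card e = l" "e \<subseteq> V" if "e \<in> E" for e using E that by (auto simp: nsets_def)
  have finE: "finite E" using E V by (meson finite_subset finite_imp_finite_nsets)
  have "(\<Union>e\<in>E. permutations_of_set e) \<subseteq> heavy_lists V y l 1"
  proof safe
    fix e xs assume "e \<in> E" "xs \<in> permutations_of_set e"
    then show "xs \<in> heavy_lists V y l 1"
      using e[of e] y(2)[of e] permutations_of_setD[of xs e]
      by (auto simp: heavy_lists_def distinct_card sum_list_distinct_conv_sum_set)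
  qed
  then have "card (\<Union>e\<in>E. permutations_of_set e) \<le> card (heavy_lists V y l 1)"
    by (intro card_mono finite_heavy_lists V)
  also have "card (\<Union>e\<in>E. permutations_of_set e) = (\<Sum>e\<in>E. card (permutations_of_set e))"
    using finE by (intro card_UN_disjoint) (auto dest: permutations_of_setD)
  also have "\<dots> = card E * fact l" using e by simp
  finally have "real (card E * fact l) \<le> real (card (heavy_lists V y l 1))" by (simp only: of_nat_le_iff)
  then have "real (card E) * fact l \<le> real (card (heavy_lists V y l 1))" by (simp only: of_nat_mult of_nat_fact)
  also note card_heavy_lists_le[OF V y(1) l d total]
  finally show ?thesis by (simp add: field_simps)
qed

subsection \<open>Fractional covers\<close>

text \<open>First-order optimality: divide by \<open>t\<close> and let \<open>t\<close> tend to 0.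
  It serves to compare the penalty at its minimiser with nearby points on a segment.\<close>

lemma linear_coeff_nonneg:
  fixes A B :: real
  assumes "\<And>t. 0 < t \<Longrightarrow> t \<le> 1 \<Longrightarrow> 0 \<le> t * A + t^2 * B"
  shows "0 \<le> A"
proof (rule ccontr)
  assume "\<not> 0 \<le> A"
  then have A: "A < 0" by simp
  define K where "K = 2 * (\<bar>B\<bar> + 1)"
  have K: "0 < K" by (simp add: K_def add_nonneg_pos)
  define t where "t = min 1 (- A / K)"
  have t: "0 < t" "t \<le> 1" using A K by (auto simp: t_def divide_neg_pos)
  have "t \<le> - A / K" by (simp add: t_def)
  then have tK: "t * K \<le> - A" using K by (simp only: pos_le_divide_eq)
  have "0 \<le> t * (A + t * B)" using assms[OF t(1,2)] by (simp add: algebra_simps power2_eq_square)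
  then have "0 \<le> A + t * B" using t by (simp add: zero_le_mult_iff)
  moreover have "t * B \<le> t * (\<bar>B\<bar> + 1)" using t by (intro mult_left_mono) auto
  moreover have "2 * (t * (\<bar>B\<bar> + 1)) = t * K" by (simp add: K_def)
  ultimately show False using tK A by linarith
qed

text \<open>Strong linear programming duality by a penalty argument: if no matching of size \<open>s\<close> exists,
  then at a weighting of total weight \<open>s\<close> that minimises the squared excess load, the excess loads
  are proportional to a fractional cover.\<close>

lemma fractional_cover_exists:
  assumes H: "uniform_hypergraph l V E" and l: "1 \<le> l" and s: "0 < s"
    and less: "fractional_matching_number V E < s"
  obtains y where "\<And>v. v \<in> V \<Longrightarrow> 0 \<le> y v" "\<And>e. e \<in> E \<Longrightarrow> 1 \<le> (\<Sum>v\<in>e. y v)" "(\<Sum>v\<in>V. y v) \<le> s"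
proof (cases "E = {}")
  case True
  then show ?thesis using that[of "\<lambda>_. 0"] s by simp
next
  case False
  have V: "finite V" and E: "E \<subseteq> nsets V l" using H by (auto simp: uniform_hypergraph_def)
  have fin: "finite E" using E V by (meson finite_subset finite_imp_finite_nsets)
  have e: "e \<subseteq> V" "finite e" "e \<noteq> {}" if "e \<in> E" for e using E that l by (auto simp: nsets_def)
  define load where "load w v = (\<Sum>e | e \<in> E \<and> v \<in> e. w e)" for w :: "'a set \<Rightarrow> real" and v
  define \<Psi> where "\<Psi> w = (\<Sum>v\<in>V. (max 0 (load w v - 1))^2)" for w
  define K where "K = {w :: 'a set \<Rightarrow> real. (\<forall>e. w e \<in> {0..s})} \<inter> {w. (\<Sum>e\<in>E. w e) = s}"
  have "compactin (product_topology (\<lambda>_. euclidean) UNIV) (\<Pi>\<^sub>E e\<in>(UNIV::'a set set). {0..s})"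
    by (subst compactin_PiE) auto
  then have c: "compact {w :: 'a set \<Rightarrow> real. (\<forall>e. w e \<in> {0..s})}"
    by (simp add: PiE_UNIV_domain Pi_def euclidean_product_topology)
  have cont: "continuous_on A (\<lambda>w. w e)" for A :: "('a set \<Rightarrow> real) set" and e
    by (rule continuous_on_subset[OF continuous_on_product_coordinates]) auto
  have "closed {w :: 'a set \<Rightarrow> real. (\<Sum>e\<in>E. w e) = s}"
    by (intro closed_Collect_eq continuous_intros cont)
  with c have K: "compact K" unfolding K_def by (rule compact_Int_closed)
  obtain e0 where "e0 \<in> E" using False by auto
  then have "(\<lambda>e. if e = e0 then s else 0) \<in> K" using s fin by (auto simp: K_def)
  then have "K \<noteq> {}" by blast
  moreover have "continuous_on K \<Psi>"
    unfolding \<Psi>_def load_def by (intro continuous_intros cont)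
  ultimately obtain w where w: "w \<in> K" "\<And>w'. w' \<in> K \<Longrightarrow> \<Psi> w \<le> \<Psi> w'"
    using continuous_attains_inf[OF K] by blast
  have w0: "0 \<le> w e" and ws: "(\<Sum>e\<in>E. w e) = s" for e using w(1) by (auto simp: K_def)
  define z where "z v = max 0 (load w v - 1)" for v
  have z0: "0 \<le> z v" for v by (simp add: z_def)
  have load_sum: "(\<Sum>v\<in>V. z v * load w v) = (\<Sum>e\<in>E. w e * (\<Sum>v\<in>e. z v))"
  proof -
    have "(\<Sum>v\<in>V. z v * load w v) = (\<Sum>v\<in>V. \<Sum>e\<in>E. if v \<in> e then z v * w e else 0)"
      unfolding load_def sum_distrib_left using fin by (simp add: sum.inter_filter)
    also have "\<dots> = (\<Sum>e\<in>E. \<Sum>v\<in>V. if v \<in> e then z v * w e else 0)" by (rule sum.swap)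
    also have "\<dots> = (\<Sum>e\<in>E. w e * (\<Sum>v\<in>e. z v))"
    proof (rule sum.cong[OF refl])
      fix e' assume "e' \<in> E"
      then have "V \<inter> {v. v \<in> e'} = e'" using e by auto
      then show "(\<Sum>v\<in>V. if v \<in> e' then z v * w e' else 0) = w e' * (\<Sum>v\<in>e'. z v)"
        using V by (simp add: sum.If_cases sum_distrib_left mult.commute)
    qed
    finally show ?thesis .
  qed
  define Z where "Z = (\<Sum>v\<in>V. z v)"
  \<comment> \<open>Without excess load, \<open>w\<close> would be a matching of size
    \<open>s\<close>. The bound \<open>w e' <= 1\<close> comes from the load at any vertex of
    \<open>e'\<close>, which exists because \<open>l >= 1\<close>.\<close>
  have Z: "0 < Z"
  proof (rule ccontr)
    assume "\<not> 0 < Z"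
    moreover have "0 \<le> Z" unfolding Z_def by (intro sum_nonneg z0)
    ultimately have "Z = 0" by simp
    then have "z v = 0" if "v \<in> V" for v using that V z0 unfolding Z_def by (subst (asm) sum_nonneg_eq_0_iff) auto
    then have load1: "load w v \<le> 1" if "v \<in> V" for v using that unfolding z_def by (smt (verit) max.cobounded2)
    have "w e' \<le> 1" if e': "e' \<in> E" for e'
    proof -
      obtain v where v: "v \<in> e'" "v \<in> V" using e[OF e'] by auto
      have "w e' \<le> load w v" unfolding load_def using fin e' v w0 by (intro member_le_sum) auto
      then show ?thesis using load1[OF v(2)] by simp
    qed
    then have "fractional_matching V E w" using w0 load1 by (auto simp: fractional_matching_def load_def)
    then have "s \<le> fractional_matching_number V E"
      using fractional_matching_number_attained(2)[OF H] ws by metis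
    then show False using less by simp
  qed
  have big: "Z < (\<Sum>v\<in>V. z v * load w v)"
  proof -
    \<comment> \<open>Wherever \<open>z v\<close> is nonzero, the load is
      \<open>1 + z v\<close>.\<close>
    have eq: "z v * load w v = z v + (z v)^2" for v
      by (auto simp: z_def max_def algebra_simps power2_eq_square)
    obtain v where "v \<in> V" "0 < z v"
      using Z z0 unfolding Z_def by (metis less_le sum_nonpos less_le_not_le)
    then have "0 < (\<Sum>v\<in>V. (z v)^2)" using V by (intro sum_pos2[of V v]) auto
    then show ?thesis unfolding eq sum.distrib Z_def by simp
  qed
  have cover: "(\<Sum>v\<in>V. z v * load w v) \<le> s * (\<Sum>v\<in>e1. z v)" if e1: "e1 \<in> E" for e1
  proof -
    \<comment> \<open>The derivative of the load as \<open>w\<close> moves towards the weighting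
      that puts all of \<open>s\<close> on \<open>e1\<close>.\<close>
    define h where "h v = s * of_bool (v \<in> e1) - load w v" for v
    have "0 \<le> t * (2 * (\<Sum>v\<in>V. z v * h v)) + t^2 * (\<Sum>v\<in>V. (h v)^2)" if t: "0 < t" "t \<le> 1" for t
    proof -
      define w' where "w' e = (1 - t) * w e + t * (if e = e1 then s else 0)" for e
      have "w' e \<in> {0..s}" for e
      proof -
        have "w e \<in> {0..s}" using w(1) by (auto simp: K_def)
        moreover have "0 \<le> (if e = e1 then s else 0)" "(if e = e1 then s else 0) \<le> s" using s by auto
        ultimately have "0 \<le> w' e" "w' e \<le> (1 - t) * s + t * s"
          unfolding w'_def using t by (intro add_nonneg_nonneg mult_nonneg_nonneg add_mono mult_left_mono; simp)+
        then show ?thesis by (simp add: algebra_simps)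
      qed
      moreover have "(\<Sum>e\<in>E. w' e) = s"
        unfolding w'_def sum.distrib sum_distrib_left[symmetric] ws using fin e1 by (simp add: algebra_simps)
      ultimately have "\<Psi> w \<le> \<Psi> w'" by (intro w(2)) (auto simp: K_def)
      also have load': "load w' v = load w v + t * h v" for v
      proof -
        have "(\<Sum>e | e \<in> E \<and> v \<in> e. if e = e1 then s else 0) = s * of_bool (v \<in> e1)"
          using fin e1 by (simp add: sum.delta')
        then show ?thesis
          unfolding load_def w'_def sum.distrib sum_distrib_left[symmetric] h_def by (simp add: load_def algebra_simps)
      qed
      have "\<Psi> w' \<le> (\<Sum>v\<in>V. (z v)^2 + t * (2 * (z v * h v)) + t^2 * (h v)^2)"
        unfolding \<Psi>_def load'
      proof (rule sum_mono)
        fix v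
        have "(max 0 (a + b))^2 \<le> (max 0 a)^2 + 2 * (max 0 a * b) + b^2" for a b :: real
        proof (cases "0 \<le> a")
          case True
          then show ?thesis by (auto simp: max_def power2_eq_square algebra_simps intro: add_nonneg_nonneg)
             (use zero_le_power2[of "a + b"] in \<open>simp add: power2_eq_square algebra_simps\<close>)
        next
          case False
          then have "\<bar>max 0 (a + b)\<bar> \<le> \<bar>b\<bar>" by (auto simp: max_def)
          then have "(max 0 (a + b))^2 \<le> b^2" by (simp only: abs_le_square_iff)
          then show ?thesis using False by simp
        qed
        from this[of "load w v - 1" "t * h v"]
        show "(max 0 (load w v + t * h v - 1))^2 \<le> (z v)^2 + t * (2 * (z v * h v)) + t^2 * (h v)^2"
          by (simp add: z_def power_mult_distrib algebra_simps)
      qed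
      also have "\<dots> = \<Psi> w + t * (2 * (\<Sum>v\<in>V. z v * h v)) + t^2 * (\<Sum>v\<in>V. (h v)^2)"
        by (simp add: \<Psi>_def z_def sum.distrib sum_distrib_left)
      finally show ?thesis by simp
    qed
    then have "0 \<le> 2 * (\<Sum>v\<in>V. z v * h v)" by (rule linear_coeff_nonneg)
    moreover have "(\<Sum>v\<in>V. z v * h v) = s * (\<Sum>v\<in>e1. z v) - (\<Sum>v\<in>V. z v * load w v)"
    proof -
      have "V \<inter> {v. v \<in> e1} = e1" using e[OF e1] by auto
      then have "(\<Sum>v\<in>V. z v * of_bool (v \<in> e1)) = (\<Sum>v\<in>e1. z v)"
        using V by (simp add: of_bool_def if_distrib[of "(*) _"] sum.If_cases cong: if_cong)
      then show ?thesis
        by (simp add: h_def right_diff_distrib sum_subtractf mult.left_commute[of _ s] flip: sum_distrib_left)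
    qed
    ultimately show ?thesis by simp
  qed
  show ?thesis
  proof (rule that[of "\<lambda>v. s * z v / Z"])
    show "0 \<le> s * z v / Z" for v using s z0 Z by simp
    show "1 \<le> (\<Sum>v\<in>e1. s * z v / Z)" if "e1 \<in> E" for e1
    proof -
      have "Z \<le> s * (\<Sum>v\<in>e1. z v)" using big cover[OF that] by simp
      then have "1 \<le> s * (\<Sum>v\<in>e1. z v) / Z" using Z by simp
      then show ?thesis by (simp add: sum_distrib_left sum_divide_distrib)
    qed
    have "(\<Sum>v\<in>V. s * z v / Z) = s * Z / Z"
      unfolding Z_def by (simp add: sum_distrib_left sum_divide_distrib)
    then show "(\<Sum>v\<in>V. s * z v / Z) \<le> s" using Z by simp
  qed
qed

subsection \<open>Asymptotics of the threshold\<close>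

lemma f0_le:
  assumes l: "l \<in> {3, 4}" and d: "1 \<le> d"
  shows "real (f0 ((real m + real d) / (real l + real d)) l m)
      \<le> (1 - (1 - 1 / (real l + real d)) ^ l) * (real m + real d) ^ l / fact l + 1"
proof -
  define s where "s = (real m + real d) / (real l + real d)"
  define B where "B = (1 - (1 - 1 / (real l + real d)) ^ l) * (real m + real d) ^ l / fact l"
  have s: "0 < s" using d by (auto simp: s_def intro!: divide_pos_pos)
  have B: "0 \<le> B"
    unfolding B_def using d by (intro divide_nonneg_pos mult_nonneg_nonneg) (auto intro!: power_le_one simp: divide_le_eq)
  have "f0 s l m \<le> nat \<lfloor>B\<rfloor> + 1"
    unfolding f0_def
  proof (rule Least_le, intro allI impI)
    fix V :: "nat set" and E
    assume *: "uniform_hypergraph l V E \<and> card V = m \<and> nat \<lfloor>B\<rfloor> + 1 \<le> card E"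
    show "s \<le> fractional_matching_number V E"
    proof (rule ccontr)
      assume "\<not> ?thesis"
      then have less: "fractional_matching_number V E < s" by simp
      have H: "uniform_hypergraph l V E" and "1 \<le> l" using * l by auto
      then obtain y where y: "\<And>v. v \<in> V \<Longrightarrow> 0 \<le> y v" "\<And>e. e \<in> E \<Longrightarrow> 1 \<le> (\<Sum>v\<in>e. y v)" "(\<Sum>v\<in>V. y v) \<le> s"
        by (rule fractional_cover_exists[OF _ _ s less]) blast+
      have "real (card E) \<le> B"
        using card_le_of_fractional_cover[OF _ l d y(1,2)] * y(3) by (auto simp: B_def s_def)
      moreover have "B < real (nat \<lfloor>B\<rfloor> + 1)" using B by linarith
      moreover have "real (nat \<lfloor>B\<rfloor> + 1) \<le> real (card E)" using * by (simp only: of_nat_le_iff)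
      ultimately show False by linarith
    qed
  qed
  then have "real (f0 s l m) \<le> real (nat \<lfloor>B\<rfloor> + 1)" by (simp only: of_nat_le_iff)
  also have "\<dots> \<le> B + 1" using B by simp
  finally show ?thesis by (simp add: s_def B_def)
qed

text \<open>In the extremal graph every edge meets \<open>T\<close>, so the size of a matching is at
  most the total load on \<open>T\<close>, hence at most \<open>k\<close>.\<close>

lemma f0_gt:
  assumes k: "real k < s" "k \<le> m"
  shows "(m choose l) - ((m - k) choose l) < f0 s l m"
proof -
  define V where "V = {..<m}"
  define T where "T = {..<k}"
  define E where "E = nsets V l - nsets (V - T) l"
  have TV: "T \<subseteq> V" "finite V" using k by (auto simp: T_def V_def)
  have H: "uniform_hypergraph l V E" using TV by (auto simp: uniform_hypergraph_def E_def)
  have sub: "nsets (V - T) l \<subseteq> nsets V l" by (auto simp: nsets_def)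
  have "card (V - T) = m - k" using TV by (simp add: card_Diff_subset finite_subset T_def V_def)
  then have card: "card E = (m choose l) - ((m - k) choose l)"
    unfolding E_def using TV sub by (subst card_Diff_subset) (auto intro: finite_subset[OF sub] simp: finite_imp_finite_nsets card_nsets V_def)
  have "fractional_matching_number V E \<le> real k"
  proof -
    obtain w where w: "fractional_matching V E w" "(\<Sum>e\<in>E. w e) = fractional_matching_number V E"
      using fractional_matching_number_attained(1)[OF H] by blast
    have fin: "finite E" using TV by (auto simp: E_def finite_imp_finite_nsets)
    have w0: "0 \<le> w e" if "e \<in> E" for e using w(1) that by (auto simp: fractional_matching_def)
    have "w e \<le> (\<Sum>v\<in>T. if v \<in> e then w e else 0)" if e: "e \<in> E" for e
    proof -
      obtain v where v: "v \<in> T" "v \<in> e" using e by (auto simp: E_def nsets_def)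
      then have "w e = (if v \<in> e then w e else 0)" by simp
      also have "\<dots> \<le> (\<Sum>v\<in>T. if v \<in> e then w e else 0)"
        using v(1) w0[OF e] by (intro member_le_sum[where f = "\<lambda>v. if v \<in> e then w e else 0"]) (auto simp: T_def)
      finally show ?thesis .
    qed
    then have "(\<Sum>e\<in>E. w e) \<le> (\<Sum>e\<in>E. \<Sum>v\<in>T. if v \<in> e then w e else 0)" by (rule sum_mono)
    also have "\<dots> = (\<Sum>v\<in>T. \<Sum>e\<in>E. if v \<in> e then w e else 0)" by (rule sum.swap)
    also have "\<dots> = (\<Sum>v\<in>T. \<Sum>e | e \<in> E \<and> v \<in> e. w e)" using fin by (simp add: sum.inter_filter)
    also have "\<dots> \<le> (\<Sum>v\<in>T. 1)"
      using w(1) TV by (intro sum_mono) (auto simp: fractional_matching_def)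
    finally show ?thesis using w(2) by (simp add: T_def)
  qed
  then have less: "fractional_matching_number V E < s" using k by simp
  let ?P = "\<lambda>M. \<forall>(V :: nat set) E.
     uniform_hypergraph l V E \<and> card V = m \<and> M \<le> card E \<longrightarrow> s \<le> fractional_matching_number V E"
  \<comment> \<open>A vacuous witness, so that the \<open>LEAST\<close> has its defining
    property.\<close>
  have "?P ((m choose l) + 1)"
  proof (intro allI impI)
    fix V :: "nat set" and E
    assume *: "uniform_hypergraph l V E \<and> card V = m \<and> (m choose l) + 1 \<le> card E"
    then have "card E \<le> card (nsets V l)"
      by (intro card_mono) (auto simp: uniform_hypergraph_def finite_imp_finite_nsets)
    then show "s \<le> fractional_matching_number V E" using * by (simp add: card_nsets uniform_hypergraph_def)
  qed
  then have "?P (f0 s l m)" unfolding f0_def by (rule LeastI)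
  then have "\<not> f0 s l m \<le> card E" using H less TV by (auto simp: V_def not_le dest!: spec[of _ V] spec[of _ E])
  then show ?thesis unfolding card by simp
qed

lemma binomial_over_power_tendsto:
  assumes "l \<in> {3, 4}"
  shows "(\<lambda>m. real (m choose l) / real m ^ l) \<longlonglongrightarrow> 1 / fact l"
proof -
  have 3: "real (m choose 3) = real m * (real m - 1) * (real m - 2) / 6" for m
    by (simp add: binomial_gbinomial gbinomial_prod_rev numeral_eq_Suc)
  have 4: "real (m choose 4) = real m * (real m - 1) * (real m - 2) * (real m - 3) / 24" for m
    by (simp add: binomial_gbinomial gbinomial_prod_rev numeral_eq_Suc)
  have "(\<lambda>m. real (m choose 3) / real m ^ 3) \<longlonglongrightarrow> 1 / 6" unfolding 3 by real_asymp
  moreover have "(\<lambda>m. real (m choose 4) / real m ^ 4) \<longlonglongrightarrow> 1 / 24" unfolding 4 by real_asymp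
  ultimately show ?thesis using assms by (auto simp: fact_numeral)
qed

theorem theorem1p3:
  fixes l d :: nat
  assumes "l \<in> {3, 4}" and "d \<ge> 1"
  shows "(\<lambda>m. real (f0 ((real m + real d) / (real l + real d)) l m))
           \<sim>[sequentially] (\<lambda>m. (1 - (1 - 1 / (real l + real d)) ^ l) * real (m choose l))"
proof (rule asymp_equivI')
  define x where "x = 1 / (real l + real d)"
  define c where "c = 1 - (1 - x) ^ l"
  define s where "s m = (real m + real d) / (real l + real d)" for m
  define b where "b m = real (m choose l) / real m ^ l" for m
  have l: "0 < l" and x: "0 < x" "x < 1" using assms by (auto simp: x_def divide_less_eq)
  have c: "0 < c" unfolding c_def using x l by (simp add: power_less_one_iff)
  have b: "b \<longlonglongrightarrow> 1 / fact l" unfolding b_def by (rule binomial_over_power_tendsto[OF assms(1)])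
  have pos: "0 < real (m choose l)" "0 < real m ^ l" "0 < real m" if "l \<le> m" for m
    using that l by auto
  let ?q = "\<lambda>m. real (f0 (s m) l m) / (c * real (m choose l))"
  have "(\<lambda>m. (c * ((real m + real d) / real m) ^ l / fact l + 1 / real m ^ l) / (c * b m))
      \<longlonglongrightarrow> (c * 1 ^ l / fact l + 0) / (c * (1 / fact l))"
  proof (intro tendsto_intros b)
    show "(\<lambda>m. (real m + real d) / real m) \<longlonglongrightarrow> 1" by real_asymp
    have "(\<lambda>m. 1 / real m) \<longlonglongrightarrow> 0" by real_asymp
    then have "(\<lambda>m. (1 / real m) ^ l) \<longlonglongrightarrow> 0 ^ l" by (rule tendsto_power)
    then show "(\<lambda>m. 1 / real m ^ l) \<longlonglongrightarrow> 0" using l by (simp add: power_divide zero_power)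
  qed (use c in auto)
  then have upper: "(\<lambda>m. (c * ((real m + real d) / real m) ^ l / fact l + 1 / real m ^ l) / (c * b m)) \<longlonglongrightarrow> 1"
    using c by simp
  have "(\<lambda>m. (1 - ((real m - s m + 1) / real m) ^ l / fact l / b m) / c)
      \<longlonglongrightarrow> (1 - (1 - x) ^ l / fact l / (1 / fact l)) / c"
  proof (intro tendsto_intros b)
    have "(\<lambda>m. (real m - (real m + real d) * x + 1) / real m) \<longlonglongrightarrow> 1 - x" by real_asymp
    then show "(\<lambda>m. (real m - s m + 1) / real m) \<longlonglongrightarrow> 1 - x" by (simp add: s_def x_def)
  qed (use c in auto)
  then have lower: "(\<lambda>m. (1 - ((real m - s m + 1) / real m) ^ l / fact l / b m) / c) \<longlonglongrightarrow> 1"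
    using c by (simp add: c_def)
  have "?q \<longlonglongrightarrow> 1"
  proof (rule tendsto_sandwich[OF _ _ lower upper])
    show "\<forall>\<^sub>F m in sequentially. ?q m \<le> (c * ((real m + real d) / real m) ^ l / fact l + 1 / real m ^ l) / (c * b m)"
    proof (rule eventually_mono[OF eventually_ge_at_top[of l]])
      fix m assume m: "l \<le> m"
      have "(c * ((real m + real d) / real m) ^ l / fact l + 1 / real m ^ l) / (c * b m)
          = (c * (real m + real d) ^ l / fact l + 1) / (c * real (m choose l))"
        using pos[OF m] c by (simp add: b_def field_simps power_divide)
      moreover have "real (f0 (s m) l m) \<le> c * (real m + real d) ^ l / fact l + 1"
        using f0_le[OF assms] by (simp add: s_def c_def x_def)
      ultimately show "?q m \<le> (c * ((real m + real d) / real m) ^ l / fact l + 1 / real m ^ l) / (c * b m)"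
        using pos[OF m] c by (simp add: divide_right_mono)
    qed
    show "\<forall>\<^sub>F m in sequentially. (1 - ((real m - s m + 1) / real m) ^ l / fact l / b m) / c \<le> ?q m"
    proof (rule eventually_mono[OF eventually_ge_at_top[of l]])
      fix m assume m: "l \<le> m"
      \<comment> \<open>The largest integer strictly below \<open>s m\<close>, also when
        \<open>s m\<close> is an integer.\<close>
      define k where "k = nat (\<lceil>s m\<rceil> - 1)"
      have s0: "0 < s m" unfolding s_def using assms by (auto intro!: divide_pos_pos)
      then have k: "real k < s m" "s m - 1 \<le> real k" unfolding k_def by linarith+
      have "1 * real d \<le> real m * real d" "1 * real m \<le> real l * real m"
        using l m by (intro mult_right_mono; simp)+
      then have "s m \<le> real m" using l by (simp add: s_def divide_le_eq algebra_simps)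
      with k have km: "k \<le> m" by linarith
      have "real (((m - k) choose l) * fact l) \<le> real ((m - k) ^ l)"
        unfolding of_nat_le_iff by (rule binomial_fact_pow)
      then have "real ((m - k) choose l) * fact l \<le> real (m - k) ^ l"
        by (simp only: of_nat_mult of_nat_power of_nat_fact)
      also have "\<dots> \<le> (real m - s m + 1) ^ l"
        using k km by (intro power_mono) (auto simp: of_nat_diff)
      finally have "real ((m - k) choose l) \<le> (real m - s m + 1) ^ l / fact l" by (simp add: field_simps)
      moreover have "real (m choose l) - real ((m - k) choose l) \<le> real (f0 (s m) l m)"
        using f0_gt[OF k(1) km, of l] by linarith
      ultimately have "real (m choose l) - (real m - s m + 1) ^ l / fact l \<le> real (f0 (s m) l m)"
        by linarith
      then have "(real (m choose l) - (real m - s m + 1) ^ l / fact l) / (c * real (m choose l)) \<le> ?q m"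
        using pos[OF m] c by (intro divide_right_mono) auto
      moreover have "(1 - ((real m - s m + 1) / real m) ^ l / fact l / b m) / c
          = (real (m choose l) - (real m - s m + 1) ^ l / fact l) / (c * real (m choose l))"
        using pos[OF m] c by (simp add: b_def field_simps power_divide)
      ultimately show "(1 - ((real m - s m + 1) / real m) ^ l / fact l / b m) / c \<le> ?q m" by simp
    qed
  qed
  then show "(\<lambda>m. real (f0 ((real m + real d) / (real l + real d)) l m)
      / ((1 - (1 - 1 / (real l + real d)) ^ l) * real (m choose l))) \<longlonglongrightarrow> 1"
    by (simp add: s_def c_def x_def)
qed
end
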